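(* Let $X=\{x_1,\dots,x_m\}$, $m\ge 1$, be a sub-source of some source. Then the enumeration algorithm described in the context, run on $X$, terminates, and the set $\Psi$ of extended states it outputs is sufficient to compute the general redundancy bound $$\mathcal{R}^{*}_{\min}(X)=\min_{\{B\,\mid\, X\sqsubseteq B\}}\mathcal{R}_H(B),$$ where $B$ ranges over sources of any finite size $|B|\ge 2$; namely, $$\mathcal{R}^{*}_{\min}(X)=\min_{\Theta\in\Psi}\ \mathcal{F}(X,C_\Theta),$$ where $C_\Theta$ is the prefix-free code represented by the single symbol in $\mathcal{K}(\Theta)$.
   Context: All logarithms are base $2$. A source $A$ of $n=|A|\ge 2$ symbols ($n$ finite) is an alphabet $\{a_1,\dots,a_n\}$ with probabilities $\mathrm{p}(a_i)>0$, $\sum_i \mathrm{p}(a_i)=1$. A sub-source $X$ of $A$, written $X\sqsubseteq A$, is a subset of the symbols of $A$ together with their probabilities; $|X|$ is its number of symbols. For a code $C$ with codeword lengths $\mathrm{l}_C$, the redundancy is $\mathcal{R}_C(B)=\sum_i \mathrm{p}(b_i)\,\mathrm{l}_C(b_i)+\sum_i \mathrm{p}(b_i)\log \mathrm{p}(b_i)$; $\mathcal{R}_H(B)$ is the redundancy of a binary Huffman code for $B$ (the minimum of $\mathcal{R}_C(B)$ over binary prefix-free codes $C$). Put $$\mathcal{T}(X)=|X|+\left\lceil\frac{1-\sum_{i=1}^m \mathrm{p}(x_i)}{\min\{\mathrm{p}(x_1),\dots,\mathrm{p}(x_m)\}}\right\rceil .$$ Extended states. Let $u_0,u_1,u_2,\dots$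 be new symbols, whose probabilities $\mathrm{p}(u_i)$ are treated as real unknowns. Symbols can be merged: $[a,b]$ is a new symbol with $\mathrm{p}([a,b])=\mathrm{p}(a)+\mathrm{p}(b)$ (a linear expression in the $\mathrm{p}(x_i)$ and $\mathrm{p}(u_i)$). An extended state is a triple $\Theta=(K,s,Z)$ with $K=\mathcal{K}(\Theta)$ a finite set of (possibly merged) symbols $\kappa_1,\dots,\kappa_{|K|}$, $s=\mathcal{S}(\Theta)$ an integer, and $Z=\mathcal{Z}(\Theta)$ a set of linear inequalities. Transition functions, for $\Theta=(K,s,Z)$: - for $i\neq j$, $\mathrm{h}_a(\Theta,i,j)=\big((K\setminus\{\kappa_i,\kappa_j\})\cup\{[\kappa_i,\kappa_j]\},\ s,\ Z'\big)$, where $Z'$ is $Z$ together with the inequalities $\mathrm{p}(\kappa_i)\le \mathrm{p}(\kappa_l)$ for all $\kappa_l\in K$, $l\ne j$; $\mathrm{p}(\kappa_j)\le \mathrm{p}(\kappa_l)$ for all $\kappa_l\in K$, $l\neq i$; $\mathrm{p}(\kappa_i)\le \mathrm{p}(u_s)$; $\mathrm{p}(\kappa_j)\le \mathrm{p}(u_s)$; - $\mathrm{h}_b(\Theta,i)=\big((K\setminus\{\kappa_i\})\cup\{[\kappa_i,u_s]\},\ s+1,\ Z''\big)$, where $Z''$ is $Z$ together with $\mathrm{p}(\kappa_i)\le \mathrm{p}(\kappa_l)$ for all $\kappa_l\in K$; $\mathrm{p}(u_s)\le \mathrm{p}(\kappa_l)$ for all $\kappa_l\in K$, $l\ne i$;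 $\mathrm{p}(\kappa_i)\le \mathrm{p}(u_{s+1})$; $\mathrm{p}(u_s)\le \mathrm{p}(u_{s+1})$. Consistency. $\mathcal{Z}(\Theta)$ is called inconsistent if there are no real values of $\mathrm{p}(u_0),\dots,\mathrm{p}(u_s)$ satisfying simultaneously, with the $\mathrm{p}(x_i)$ fixed to their given values: all inequalities in $\mathcal{Z}(\Theta)$, $\sum_{i=1}^{m}\mathrm{p}(x_i)+\sum_{i=0}^{s-1}\mathrm{p}(u_i)\le 1$, and $\mathrm{p}(u_s)=1$ (where $s=\mathcal{S}(\Theta)$). Enumeration algorithm. 1. Let $\Phi^{(0)}=\{(\{x_1,\dots,x_m\},\,0,\,\{0\le \mathrm{p}(u_0)\})\}$, $\Psi\gets\emptyset$, $i\gets 0$. 2. $\Pi_1=\{\mathrm{h}_a(\Theta,j,k)\mid \Theta\in\Phi^{(i)},\ 1\le j<k\le |\mathcal{K}(\Theta)|\}$. 3. $\Pi_2=\{\mathrm{h}_b(\Theta,j)\mid \Theta\in\Phi^{(i)},\ 1\le j\le|\mathcal{K}(\Theta)|,\ |X|+\mathcal{S}(\Theta)<\mathcal{T}(X)\}$. 4. $\Phi^{(i+1)}=\{\Theta\in\Pi_1\cup\Pi_2\mid \mathcal{Z}(\Theta)\text{ is not inconsistent}\}$. 5. $\Psi\gets\Psi\cup\{\Theta\in\Phi^{(i+1)}\mid |\mathcal{K}(\Theta)|=1\}$. 6. $i\gets i+1$. 7. If $\Phi^{(i)}\ne\emptyset$, go to step 2. 8. Stop. Codes and the inner minimum. If $|\mathcal{K}(\Theta)|=1$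 and $\Theta\in\Psi$, the single symbol of $\mathcal{K}(\Theta)$ is a nested bracketing, i.e. a full binary tree with leaves $x_1,\dots,x_m,u_0,\dots,u_{\mathcal{S}(\Theta)-1}$; it represents a prefix-free code $C_\Theta$ whose codeword length for a symbol is the depth of the corresponding leaf. For such a code $C$ on an alphabet of $n=m+\mathcal{S}(\Theta)$ symbols, $\mathcal{F}(X,C)=\min\{\mathcal{R}_C(B)\mid X\sqsubseteq B,\ |B|=n\}$, where $B$ ranges over sources on that alphabet in which the $x_i$ have their given probabilities; $\mathcal{F}(X,C)=+\infty$ if no such $B$ exists. *)

theory Defs
  imports
    Complex_Main
    "HOL-Library.Extended_Real"
    "HOL-Library.Sublist"
    "HOL-Library.While_Combinator"
begin

definition is_minimum :: "'b::order \<Rightarrow> 'b set \<Rightarrow> bool" where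
  "is_minimum v S \<longleftrightarrow> v \<in> S \<and> (\<forall>w\<in>S. v \<le> w)"

definition minimum :: "'b::order set \<Rightarrow> 'b" where
  "minimum S = (THE v. is_minimum v S)"

text \<open>A set of symbols together with their probabilities is a partial map; its domain is the
  alphabet.\<close>

type_synonym 'a prob_map = "'a \<rightharpoonup> real"

abbreviation pr :: "'a prob_map \<Rightarrow> 'a \<Rightarrow> real" where
  "pr B a \<equiv> the (B a)"

definition is_source :: "'a prob_map \<Rightarrow> bool" where
  "is_source A \<longleftrightarrow> finite (dom A) \<and> 2 \<le> card (dom A) \<and>
     (\<forall>a\<in>dom A. 0 < pr A a) \<and> (\<Sum>a\<in>dom A. pr A a) = 1"

definition sub_source :: "'a prob_map \<Rightarrow> 'a prob_map \<Rightarrow> bool"  (infix "\<sqsubseteq>" 50) where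
  "X \<sqsubseteq> A \<longleftrightarrow> X \<subseteq>\<^sub>m A"

type_synonym 'a code = "'a \<Rightarrow> bool list"

definition prefix_free_on :: "'a set \<Rightarrow> 'a code \<Rightarrow> bool" where
  "prefix_free_on S C \<longleftrightarrow> (\<forall>a\<in>S. \<forall>b\<in>S. a \<noteq> b \<longrightarrow> \<not> prefix (C a) (C b))"

definition redundancy :: "'a code \<Rightarrow> 'a prob_map \<Rightarrow> real" where
  "redundancy C B = (\<Sum>b\<in>dom B. pr B b * real (length (C b))) +
     (\<Sum>b\<in>dom B. pr B b * log 2 (pr B b))"

text \<open>Huffman codes attain the least expected length among prefix-free codes, so this is the
  redundancy of any Huffman code for \<open>B\<close>.\<close>

definition huffman_redundancy :: "'a prob_map \<Rightarrow> real" where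
  "huffman_redundancy B = minimum {redundancy C B |C. prefix_free_on (dom B) C}"

definition huffman_redundancies :: "'a prob_map \<Rightarrow> real set" where
  "huffman_redundancies X = {huffman_redundancy B |B. is_source B \<and> X \<sqsubseteq> B}"

definition general_bound :: "'a prob_map \<Rightarrow> real" where
  "general_bound X = minimum (huffman_redundancies X)"

definition code_bound :: "'a prob_map \<Rightarrow> 'a set \<Rightarrow> 'a code \<Rightarrow> ereal" where
  "code_bound X S C =
     (let Bs = {B. is_source B \<and> X \<sqsubseteq> B \<and> dom B = S}
      in if Bs = {} then \<infinity> else ereal (minimum (redundancy C ` Bs)))"

definition size_bound :: "'a prob_map \<Rightarrow> int" where
  "size_bound X = int (card (dom X)) +
     \<lceil>(1 - (\<Sum>x\<in>dom X. pr X x)) / Min (pr X ` dom X)\<rceil>"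

datatype 'a sym = Atom 'a | Merge "'a sym" "'a sym"

primrec leaves :: "'a sym \<Rightarrow> 'a set" where
  "leaves (Atom a) = {a}"
| "leaves (Merge k l) = leaves k \<union> leaves l"

primrec sym_prob :: "('a \<Rightarrow> real) \<Rightarrow> 'a sym \<Rightarrow> real" where
  "sym_prob q (Atom a) = q a"
| "sym_prob q (Merge k l) = sym_prob q k + sym_prob q l"

text \<open>For pairwise distinct leaves, the length of the codeword of a leaf is its depth.\<close>

primrec tree_code :: "'a sym \<Rightarrow> 'a code" where
  "tree_code (Atom b) a = []"
| "tree_code (Merge k l) a =
     (if a \<in> leaves k then False # tree_code k a else True # tree_code l a)"

text \<open>\<open>Nonneg k\<close> is the linear inequality \<open>0 \<le> p(k)\<close>, and \<open>Leq k l\<close> is \<open>p(k) \<le> p(l)\<close>.\<close>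

datatype 'a ineq = Nonneg "'a sym" | Leq "'a sym" "'a sym"

primrec satisfies :: "('a \<Rightarrow> real) \<Rightarrow> 'a ineq \<Rightarrow> bool" where
  "satisfies q (Nonneg k) \<longleftrightarrow> 0 \<le> sym_prob q k"
| "satisfies q (Leq k l) \<longleftrightarrow> sym_prob q k \<le> sym_prob q l"

datatype 'a ext_state = State (symbols: "'a sym set") (index: nat) (ineqs: "'a ineq set")

text \<open>The symbols of a finite set \<open>K\<close> are numbered \<open>\<kappa> K 1, \<dots>, \<kappa> K (card K)\<close>;
  the numbering \<open>\<kappa>\<close> is a parameter. The new symbols are \<open>u 0, u 1, \<dots>\<close>.\<close>

definition is_numbering :: "('a sym set \<Rightarrow> nat \<Rightarrow> 'a sym) \<Rightarrow> bool" where
  "is_numbering \<kappa> \<longleftrightarrow> (\<forall>K. finite K \<longrightarrow> bij_betw (\<kappa> K) {1..card K} K)"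

definition step_a ::
  "(nat \<Rightarrow> 'a) \<Rightarrow> ('a sym set \<Rightarrow> nat \<Rightarrow> 'a sym) \<Rightarrow> 'a ext_state \<Rightarrow> nat \<Rightarrow> nat \<Rightarrow> 'a ext_state" where
  "step_a u \<kappa> \<Theta> i j =
     (let K = symbols \<Theta>; s = index \<Theta>; k = \<kappa> K in
      State ((K - {k i, k j}) \<union> {Merge (k i) (k j)}) s
        (ineqs \<Theta>
         \<union> {Leq (k i) (k l) |l. l \<in> {1..card K} \<and> l \<noteq> j}
         \<union> {Leq (k j) (k l) |l. l \<in> {1..card K} \<and> l \<noteq> i}
         \<union> {Leq (k i) (Atom (u s)), Leq (k j) (Atom (u s))}))"

definition step_b ::
  "(nat \<Rightarrow> 'a) \<Rightarrow> ('a sym set \<Rightarrow> nat \<Rightarrow> 'a sym) \<Rightarrow> 'a ext_state \<Rightarrow> nat \<Rightarrow> 'a ext_state" where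
  "step_b u \<kappa> \<Theta> i =
     (let K = symbols \<Theta>; s = index \<Theta>; k = \<kappa> K in
      State ((K - {k i}) \<union> {Merge (k i) (Atom (u s))}) (s + 1)
        (ineqs \<Theta>
         \<union> {Leq (k i) (k l) |l. l \<in> {1..card K}}
         \<union> {Leq (Atom (u s)) (k l) |l. l \<in> {1..card K} \<and> l \<noteq> i}
         \<union> {Leq (k i) (Atom (u (s + 1))), Leq (Atom (u s)) (Atom (u (s + 1)))}))"

text \<open>The inequalities of a reachable state only mention the symbols of \<open>X\<close> and
  \<open>u 0, \<dots>, u (index \<Theta>)\<close>, so the values of \<open>q\<close> elsewhere are irrelevant.\<close>

definition consistent :: "(nat \<Rightarrow> 'a) \<Rightarrow> 'a prob_map \<Rightarrow> 'a ext_state \<Rightarrow> bool" where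
  "consistent u X \<Theta> \<longleftrightarrow>
     (\<exists>q :: 'a \<Rightarrow> real.
        (\<forall>x\<in>dom X. q x = pr X x) \<and>
        (\<forall>c\<in>ineqs \<Theta>. satisfies q c) \<and>
        (\<Sum>x\<in>dom X. pr X x) + (\<Sum>i<index \<Theta>. q (u i)) \<le> 1 \<and>
        q (u (index \<Theta>)) = 1)"

definition next_states ::
  "(nat \<Rightarrow> 'a) \<Rightarrow> ('a sym set \<Rightarrow> nat \<Rightarrow> 'a sym) \<Rightarrow> 'a prob_map \<Rightarrow> 'a ext_state set \<Rightarrow> 'a ext_state set"
  where
  "next_states u \<kappa> X \<Phi> =
     (let \<Pi>1 = {step_a u \<kappa> \<Theta> j k |\<Theta> j k. \<Theta> \<in> \<Phi> \<and> 1 \<le> j \<and> j < k \<and> k \<le> card (symbols \<Theta>)};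
          \<Pi>2 = {step_b u \<kappa> \<Theta> j |\<Theta> j. \<Theta> \<in> \<Phi> \<and> 1 \<le> j \<and> j \<le> card (symbols \<Theta>) \<and>
                  int (card (dom X)) + int (index \<Theta>) < size_bound X}
      in {\<Theta> \<in> \<Pi>1 \<union> \<Pi>2. consistent u X \<Theta>})"

type_synonym 'a loop_state = "'a ext_state set \<times> 'a ext_state set \<times> nat"

definition loop_body ::
  "(nat \<Rightarrow> 'a) \<Rightarrow> ('a sym set \<Rightarrow> nat \<Rightarrow> 'a sym) \<Rightarrow> 'a prob_map \<Rightarrow> 'a loop_state \<Rightarrow> 'a loop_state" where
  "loop_body u \<kappa> X =
     (\<lambda>(\<Phi>, \<Psi>, i).
        let \<Phi>' = next_states u \<kappa> X \<Phi>
        in (\<Phi>', \<Psi> \<union> {\<Theta> \<in> \<Phi>'. card (symbols \<Theta>) = 1}, i + 1))"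

definition initial_loop_state :: "(nat \<Rightarrow> 'a) \<Rightarrow> 'a prob_map \<Rightarrow> 'a loop_state" where
  "initial_loop_state u X = ({State (Atom ` dom X) 0 {Nonneg (Atom (u 0))}}, {}, 0)"

text \<open>The exit test is at the end of the body, so the body is run once before the while loop.
  The result is \<open>None\<close> iff the loop does not terminate.\<close>

definition enumeration ::
  "(nat \<Rightarrow> 'a) \<Rightarrow> ('a sym set \<Rightarrow> nat \<Rightarrow> 'a sym) \<Rightarrow> 'a prob_map \<Rightarrow> 'a loop_state option" where
  "enumeration u \<kappa> X =
     while_option (\<lambda>(\<Phi>, \<Psi>, i). \<Phi> \<noteq> {}) (loop_body u \<kappa> X)
       (loop_body u \<kappa> X (initial_loop_state u X))"

definition state_bound :: "'a prob_map \<Rightarrow> 'a ext_state \<Rightarrow> ereal" where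
  "state_bound X \<Theta> =
     (let t = the_elem (symbols \<Theta>) in code_bound X (leaves t) (tree_code t))"

end

theory Submission
  imports Defs "HOL-Combinatorics.Transposition"
begin

text \<open>Take any source \<open>B\<close> containing \<open>X\<close>, sort its new symbols by probability as
  \<open>u 0, u 1, \<dots>\<close>, and run Huffman's algorithm. As long as it never merges two new symbols with each
  other, every step is one of the two transitions of the enumeration, with the probabilities
  of \<open>B\<close> witnessing consistency; moreover all new symbols but \<open>u 0\<close> are then at least as
  probable as the least symbol of \<open>X\<close>, which bounds their number. If two new symbols
  are to be merged, replacing them by a single new symbol does not increase the redundancy, so
  one can start again with fewer new symbols. Hence some output code does as well on some source as
  the Huffman code of \<open>B\<close>. Conversely, no code beats the Huffman code. The minima exist because
  there are finitely many output codes and, by Gibbs' inequality, a best source for each of them.\<close>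

section \<open>Trees\<close>

text \<open>Huffman's algorithm is not executed as such. A run carries along an outer tree whose
  leaves are the symbols still to be merged; expanded to the original symbols, it never costs more
  than the code from which the run started. Each transition is thus an exchange argument on the
  outer tree, and when a single leaf is left, that leaf is the output code. The transitions also
  compare symbols with the next new symbol \<open>u s\<close> when the source has none left. Giving
  it the value 1, which no probability exceeds, makes these comparisons true, in agreement with the
  consistency test. For a pair of new symbols there is no transition at all. Contracting such a
  pair, of probabilities \<open>x\<close> and \<open>y\<close>, saves \<open>x + y\<close> in
  expected length, while the sum of the terms \<open>p * log 2 p\<close> grows by at most
  \<open>x + y\<close>, because a binary choice has at most one bit of entropy.\<close>

primrec distinct_leaves :: "'a sym \<Rightarrow> bool" where
  "distinct_leaves (Atom a) \<longleftrightarrow> True"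
| "distinct_leaves (Merge k l) \<longleftrightarrow>
     distinct_leaves k \<and> distinct_leaves l \<and> leaves k \<inter> leaves l = {}"

text \<open>This is the expected codeword length, as a sum over inner nodes: each merge deepens all
  leaves below it by one and so adds their total weight.\<close>

primrec cost :: "('a \<Rightarrow> real) \<Rightarrow> 'a sym \<Rightarrow> real" where
  "cost q (Atom a) = 0"
| "cost q (Merge k l) = cost q k + cost q l + sym_prob q k + sym_prob q l"

abbreviation depth :: "'a sym \<Rightarrow> 'a \<Rightarrow> nat" where
  "depth t a \<equiv> length (tree_code t a)"

lemma finite_leaves [simp]: "finite (leaves t)"
  by (induction t) auto

lemma leaves_nonempty [simp]: "leaves t \<noteq> {}"
  by (induction t) auto

lemma card_leaves_eq_1: "card (leaves t) = 1 \<Longrightarrow> distinct_leaves t \<Longrightarrow> \<exists>a. t = Atom a"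
proof (cases t)
  case (Merge k l)
  assume *: "card (leaves t) = 1" "distinct_leaves t"
  have "card (leaves k) > 0" "card (leaves l) > 0"
    by (simp_all add: card_gt_0_iff)
  moreover have "card (leaves t) = card (leaves k) + card (leaves l)"
    using * Merge by (simp add: card_Un_disjoint)
  ultimately show ?thesis
    using * by linarith
qed auto

lemma sym_prob_cong: "(\<And>a. a \<in> leaves t \<Longrightarrow> q a = r a) \<Longrightarrow> sym_prob q t = sym_prob r t"
  by (induction t) auto

lemma cost_cong: "(\<And>a. a \<in> leaves t \<Longrightarrow> q a = r a) \<Longrightarrow> cost q t = cost r t"
  by (induction t) (auto cong: sym_prob_cong)

lemma sym_prob_eq_sum: "distinct_leaves t \<Longrightarrow> sym_prob q t = sum q (leaves t)"
  by (induction t) (auto simp: sum.union_disjoint)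

lemma cost_eq_sum:
  "distinct_leaves t \<Longrightarrow> cost q t = (\<Sum>a\<in>leaves t. q a * real (depth t a))"
proof (induction t)
  case (Merge k l)
  have "(\<Sum>a\<in>leaves k \<union> leaves l. q a * real (depth (Merge k l) a)) =
     (\<Sum>a\<in>leaves k. q a * real (depth (Merge k l) a)) +
     (\<Sum>a\<in>leaves l. q a * real (depth (Merge k l) a))"
    using Merge.prems by (simp add: sum.union_disjoint)
  also have "(\<Sum>a\<in>leaves k. q a * real (depth (Merge k l) a)) =
      (\<Sum>a\<in>leaves k. q a * real (depth k a) + q a)"
    by (rule sum.cong) (auto simp: algebra_simps)
  also have "(\<Sum>a\<in>leaves l. q a * real (depth (Merge k l) a)) =
      (\<Sum>a\<in>leaves l. q a * real (depth l a) + q a)"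
    using Merge.prems by (intro sum.cong) (auto simp: algebra_simps)
  finally show ?case
    using Merge by (simp add: sum.distrib sym_prob_eq_sum)
qed simp

lemma prefix_free_tree_code: "distinct_leaves t \<Longrightarrow> prefix_free_on (leaves t) (tree_code t)"
  unfolding prefix_free_on_def
proof (induction t)
  case (Merge k l)
  then show ?case by auto
qed auto

lemma leaves_map_sym [simp]: "leaves (map_sym f t) = f ` leaves t"
  by (induction t) auto

lemma sym_prob_map_sym: "sym_prob q (map_sym f t) = sym_prob (q \<circ> f) t"
  by (induction t) auto

lemma cost_map_sym: "cost q (map_sym f t) = cost (q \<circ> f) t"
  by (induction t) (auto simp: sym_prob_map_sym comp_def)

lemma distinct_leaves_map_sym:
  "inj_on f (leaves t) \<Longrightarrow> distinct_leaves t \<Longrightarrow> distinct_leaves (map_sym f t)"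
proof (induction t)
  case (Merge k l)
  then have "f ` leaves k \<inter> f ` leaves l = f ` (leaves k \<inter> leaves l)"
    by (intro inj_on_image_Int[symmetric, where C = "leaves (Merge k l)"]) auto
  with Merge show ?case
    by (auto simp: inj_on_Un)
qed auto

lemma depth_map_sym:
  "inj f \<Longrightarrow> depth (map_sym f t) (f a) = depth t a"
  by (induction t) (auto simp: inj_image_mem_iff)

section \<open>The greedy choice\<close>

text \<open>\<open>t'\<close> is \<open>t\<close> with the sibling leaves \<open>c\<close> and \<open>d\<close> contracted to the leaf \<open>z\<close>.\<close>

definition deepest_siblings :: "'a sym \<Rightarrow> 'a \<Rightarrow> 'a \<Rightarrow> 'a \<Rightarrow> 'a sym \<Rightarrow> bool" where
  "deepest_siblings t z c d t' \<longleftrightarrow>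
     c \<in> leaves t \<and> d \<in> leaves t \<and> c \<noteq> d \<and> depth t d = depth t c \<and>
     (\<forall>e\<in>leaves t. depth t e \<le> depth t c) \<and>
     distinct_leaves t' \<and> leaves t' = insert z (leaves t - {c, d}) \<and>
     (\<forall>w. sym_prob w t = sym_prob (w(z := w c + w d)) t' \<and>
          cost w t = cost (w(z := w c + w d)) t' + w c + w d)"

text \<open>The hypothesis \<open>deep\<close> keeps \<open>c\<close> deepest in the larger tree.
  Since \<open>z\<close> is fresh, its new weight has no effect on \<open>r\<close>.\<close>

lemma deepest_siblings_left:
  assumes "deepest_siblings l z c d l'" and deep: "\<And>e. e \<in> leaves r \<Longrightarrow> depth r e \<le> depth l c"
    and dist: "distinct_leaves (Merge l r)" and z: "z \<notin> leaves (Merge l r)"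
  shows "deepest_siblings (Merge l r) z c d (Merge l' r)"
proof -
  have other: "sym_prob (w(z := x)) r = sym_prob w r" "cost (w(z := x)) r = cost w r" for w x
    using z by (auto intro!: sym_prob_cong cost_cong)
  have *: "c \<in> leaves l" "d \<in> leaves l" "c \<noteq> d" "depth l d = depth l c"
    "\<And>e. e \<in> leaves l \<Longrightarrow> depth l e \<le> depth l c"
    "distinct_leaves l'" "leaves l' = insert z (leaves l - {c, d})"
    and w: "\<And>w. sym_prob w l = sym_prob (w(z := w c + w d)) l'"
    "\<And>w. cost w l = cost (w(z := w c + w d)) l' + w c + w d"
    using assms(1) by (auto simp: deepest_siblings_def)
  have cd: "c \<notin> leaves r" "d \<notin> leaves r"
    using * dist by auto
  show ?thesis
    unfolding deepest_siblings_def
  proof (intro conjI allI)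
    show "sym_prob w (Merge l r) = sym_prob (w(z := w c + w d)) (Merge l' r)" for w
      using w(1)[of w] by (simp add: other)
    show "cost w (Merge l r) = cost (w(z := w c + w d)) (Merge l' r) + w c + w d" for w
      using w(1)[of w] w(2)[of w] by (simp add: other)
    show "distinct_leaves (Merge l' r)" "leaves (Merge l' r) = insert z (leaves (Merge l r) - {c, d})"
      using * dist cd z by auto
    show "\<forall>e\<in>leaves (Merge l r). depth (Merge l r) e \<le> depth (Merge l r) c"
      using *(1,5) deep cd by auto
  qed (use * cd in simp_all)
qed

lemma deepest_siblings_right:
  assumes "deepest_siblings r z c d r'" and deep: "\<And>e. e \<in> leaves l \<Longrightarrow> depth l e \<le> depth r c"
    and dist: "distinct_leaves (Merge l r)" and z: "z \<notin> leaves (Merge l r)"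
  shows "deepest_siblings (Merge l r) z c d (Merge l r')"
proof -
  have other: "sym_prob (w(z := x)) l = sym_prob w l" "cost (w(z := x)) l = cost w l" for w x
    using z by (auto intro!: sym_prob_cong cost_cong)
  have *: "c \<in> leaves r" "d \<in> leaves r" "c \<noteq> d" "depth r d = depth r c"
    "\<And>e. e \<in> leaves r \<Longrightarrow> depth r e \<le> depth r c"
    "distinct_leaves r'" "leaves r' = insert z (leaves r - {c, d})"
    and w: "\<And>w. sym_prob w r = sym_prob (w(z := w c + w d)) r'"
    "\<And>w. cost w r = cost (w(z := w c + w d)) r' + w c + w d"
    using assms(1) by (auto simp: deepest_siblings_def)
  have cd: "c \<notin> leaves l" "d \<notin> leaves l"
    using * dist by auto
  show ?thesis
    unfolding deepest_siblings_def
  proof (intro conjI allI)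
    show "sym_prob w (Merge l r) = sym_prob (w(z := w c + w d)) (Merge l r')" for w
      using w(1)[of w] by (simp add: other)
    show "cost w (Merge l r) = cost (w(z := w c + w d)) (Merge l r') + w c + w d" for w
      using w(1)[of w] w(2)[of w] by (simp add: other)
    show "distinct_leaves (Merge l r')" "leaves (Merge l r') = insert z (leaves (Merge l r) - {c, d})"
      using * dist cd z by auto
    show "\<forall>e\<in>leaves (Merge l r). depth (Merge l r) e \<le> depth (Merge l r) c"
      using *(1,5) deep cd by auto
  qed (use * cd in simp_all)
qed

text \<open>The sibling of a leaf of maximal depth is itself a leaf. The induction descends into a
  subtree that contains a deepest leaf.\<close>

lemma ex_deepest_siblings:
  assumes "distinct_leaves t" and "z \<notin> leaves t" and "\<And>a. t \<noteq> Atom a"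
  shows "\<exists>c d t'. deepest_siblings t z c d t'"
  using assms
proof (induction t)
  case (Merge l r)
  have IHl: "\<exists>c d t'. deepest_siblings l z c d t'" if "\<And>a. l \<noteq> Atom a"
    using Merge that by simp
  have IHr: "\<exists>c d t'. deepest_siblings r z c d t'" if "\<And>a. r \<noteq> Atom a"
    using Merge that by simp
  show ?case
  proof (cases "\<exists>a. l = Atom a")
    case True
    then obtain a where a: "l = Atom a" by blast
    show ?thesis
    proof (cases "\<exists>b. r = Atom b")
      case True
      then obtain b where "r = Atom b" by blast
      with a Merge.prems have "deepest_siblings (Merge l r) z a b (Atom z)"
        by (auto simp: deepest_siblings_def)
      then show ?thesis by blast
    next
      case False
      with IHr obtain c d t' where "deepest_siblings r z c d t'" by blast
      then have "deepest_siblings (Merge l r) z c d (Merge l t')"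
        using a Merge.prems by (intro deepest_siblings_right) auto
      then show ?thesis by blast
    qed
  next
    case False
    with IHl obtain c d t' where l: "deepest_siblings l z c d t'" by blast
    show ?thesis
    proof (cases "\<forall>e\<in>leaves r. depth r e \<le> depth l c")
      case True
      with l Merge.prems have "deepest_siblings (Merge l r) z c d (Merge t' r)"
        by (intro deepest_siblings_left) auto
      then show ?thesis by blast
    next
      case False
      then obtain e where e: "e \<in> leaves r" "depth l c < depth r e"
        by force
      then have "\<And>a. r \<noteq> Atom a" by auto
      with IHr obtain c' d' t'' where r: "deepest_siblings r z c' d' t''" by blast
      have "depth l f \<le> depth r c'" if "f \<in> leaves l" for f
      proof -
        have "depth l f \<le> depth l c" "depth r e \<le> depth r c'"
          using l r e that by (auto simp: deepest_siblings_def)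
        with e show ?thesis by linarith
      qed
      with r Merge.prems have "deepest_siblings (Merge l r) z c' d' (Merge l t'')"
        by (intro deepest_siblings_right) auto
      then show ?thesis by blast
    qed
  qed
qed blast

text \<open>Renaming leaves permutes their weights. Moving the lighter weight to the deeper place
  saves the product of the difference in weight and the difference in depth.\<close>

lemma cost_map_sym_transpose_le:
  assumes "distinct_leaves t" and "a \<in> leaves t" and "c \<in> leaves t"
    and "w a \<le> w c" and "depth t a \<le> depth t c"
  shows "cost w (map_sym (transpose a c) t) \<le> cost w t"
proof (cases "a = c")
  case False
  let ?S = "leaves t - {a, c}" and ?f = "\<lambda>w x. w x * real (depth t x)"
  have split: "cost v t = sum (?f v) ?S + ?f v a + ?f v c" for v
  proof -
    have "cost v t = sum (?f v) (insert a (insert c ?S))"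
      using assms by (subst cost_eq_sum) (auto intro!: sum.cong)
    also have "\<dots> = sum (?f v) ?S + ?f v a + ?f v c"
      using False by (subst sum.insert; simp)
    finally show ?thesis .
  qed
  have "sum (?f (w \<circ> transpose a c)) ?S = sum (?f w) ?S"
    by (rule sum.cong) auto
  moreover have "0 \<le> (w c - w a) * (real (depth t c) - real (depth t a))"
    using assms by simp
  ultimately show ?thesis
    by (simp add: cost_map_sym split algebra_simps)
qed (simp add: cost_map_sym)

text \<open>Two exchanges bring the lightest leaves \<open>a\<close> and \<open>b\<close> to the
  places of two deepest siblings, which are then contracted to \<open>z\<close>. The order of
  \<open>a\<close> and \<open>b\<close> matters because the exchanges are made one after the
  other.\<close>

lemma greedy_choice_ordered:
  assumes t: "distinct_leaves t" and ab: "a \<in> leaves t" "b \<in> leaves t" "a \<noteq> b"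
    and z: "z \<notin> leaves t" and "w a \<le> w b"
    and least: "\<And>c. c \<in> leaves t - {a, b} \<Longrightarrow> w b \<le> w c"
  shows "\<exists>t'. distinct_leaves t' \<and> leaves t' = insert z (leaves t - {a, b}) \<and>
           cost (w(z := w a + w b)) t' + w a + w b \<le> cost w t"
proof -
  have "t \<noteq> Atom e" for e
    using ab by auto
  with ex_deepest_siblings[OF t z] obtain c d t0 where sib: "deepest_siblings t z c d t0"
    by blast
  then have cd: "c \<in> leaves t" "d \<in> leaves t" "c \<noteq> d" "depth t d = depth t c"
    and deep: "\<And>e. e \<in> leaves t \<Longrightarrow> depth t e \<le> depth t c"
    and t0: "distinct_leaves t0" "leaves t0 = insert z (leaves t - {c, d})"
    and cost0: "\<And>w. cost w t = cost (w(z := w c + w d)) t0 + w c + w d"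
    by (auto simp: deepest_siblings_def)
  define f where "f = transpose a c"
  \<comment> \<open>The first exchange may have renamed \<open>d\<close>: if \<open>d\<close> is
    \<open>a\<close>, the leaf at its place is now called \<open>c\<close>.\<close>
  define g where "g = transpose b (f d)"
  have f: "f ` leaves t = leaves t" "inj f" "f c = a"
    unfolding f_def using ab cd by simp_all
  have fz: "f z = z"
    unfolding f_def using ab cd z by (intro transpose_apply_other) auto
  have fd: "f d \<in> leaves t" "f d \<noteq> a"
    using f cd by (blast, metis injD)
  have g: "g ` leaves t = leaves t" "inj g" "g (f d) = b"
    unfolding g_def using ab fd by simp_all
  have gz: "g z = z" and ga: "g a = a"
    unfolding g_def using ab fd z by (auto intro!: transpose_apply_other)
  let ?t1 = "map_sym f t"
  have t1: "distinct_leaves ?t1" "leaves ?t1 = leaves t"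
    using distinct_leaves_map_sym[OF inj_on_subset[OF f(2) subset_UNIV] t] f by simp_all
  have "w a \<le> w c"
    using \<open>w a \<le> w b\<close> least[of c] cd by (cases "c = a"; cases "c = b") auto
  then have "cost w ?t1 \<le> cost w t"
    unfolding f_def using t ab cd deep by (intro cost_map_sym_transpose_le) auto
  moreover have "cost w (map_sym g ?t1) \<le> cost w ?t1"
    unfolding g_def
  proof (rule cost_map_sym_transpose_le)
    show "w b \<le> w (f d)"
      using least[of "f d"] fd by (cases "f d = b") auto
    obtain e where e: "e \<in> leaves t" "b = f e"
      using ab f by (metis imageE)
    then show "depth ?t1 b \<le> depth ?t1 (f d)"
      using f cd deep by (simp add: depth_map_sym)
  qed (use t1 ab fd in auto)
  moreover have "cost w (map_sym g ?t1) = cost (w \<circ> (g \<circ> f)) t"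
    by (simp add: cost_map_sym comp_assoc)
  \<comment> \<open>The contraction identity holds for all weights, hence for the permuted ones,
    under which \<open>c\<close> and \<open>d\<close> weigh \<open>w a\<close> and
    \<open>w b\<close>.\<close>
  moreover have "cost (w \<circ> (g \<circ> f)) t = cost ((w \<circ> (g \<circ> f))(z := w a + w b)) t0 + w a + w b"
    by (subst cost0) (simp add: f g ga)
  moreover have "(w \<circ> (g \<circ> f))(z := w a + w b) = w(z := w a + w b) \<circ> (g \<circ> f)"
  proof
    fix x
    have "(g \<circ> f) x = z \<longleftrightarrow> x = z"
      using inj_compose[OF g(2) f(2)] fz gz by (metis comp_apply injD)
    then show "((w \<circ> (g \<circ> f))(z := w a + w b)) x = (w(z := w a + w b) \<circ> (g \<circ> f)) x"
      by (cases "x = z") auto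
  qed
  ultimately have *: "cost (w(z := w a + w b)) (map_sym (g \<circ> f) t0) + w a + w b \<le> cost w t"
    by (simp add: cost_map_sym)
  have inj: "inj (g \<circ> f)"
    by (rule inj_compose[OF g(2) f(2)])
  have gf: "(g \<circ> f) ` leaves t = leaves t"
    using f(1) g(1) by (simp only: image_comp[symmetric])
  have "(g \<circ> f) ` leaves t0 = insert ((g \<circ> f) z) ((g \<circ> f) ` leaves t - {(g \<circ> f) c, (g \<circ> f) d})"
    unfolding t0(2) by (simp only: image_insert image_set_diff[OF inj] image_empty)
  then have "leaves (map_sym (g \<circ> f) t0) = insert z (leaves t - {a, b})"
    unfolding gf leaves_map_sym by (simp add: f g fz gz ga)
  moreover have "distinct_leaves (map_sym (g \<circ> f) t0)"
    using distinct_leaves_map_sym[OF inj_on_subset[OF inj subset_UNIV] t0(1)] .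
  ultimately show ?thesis
    using * by blast
qed

lemma greedy_choice:
  assumes "distinct_leaves t" and "a \<in> leaves t" "b \<in> leaves t" "a \<noteq> b"
    and "z \<notin> leaves t"
    and "\<And>c. c \<in> leaves t - {a, b} \<Longrightarrow> w a \<le> w c \<and> w b \<le> w c"
  shows "\<exists>t'. distinct_leaves t' \<and> leaves t' = insert z (leaves t - {a, b}) \<and>
           cost (w(z := w a + w b)) t' + w a + w b \<le> cost w t"
proof (cases "w a \<le> w b")
  case True
  with assms show ?thesis
    by (intro greedy_choice_ordered) auto
next
  case False
  with assms have "\<exists>t'. distinct_leaves t' \<and> leaves t' = insert z (leaves t - {b, a}) \<and>
           cost (w(z := w b + w a)) t' + w b + w a \<le> cost w t"
    by (intro greedy_choice_ordered) auto
  then show ?thesis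
    by (simp add: insert_commute add_ac)
qed

section \<open>Prefix-free codes\<close>

text \<open>The first bits of the codewords split the symbols into the two subtrees. If all first
  bits agree, that bit is dropped without a branching; hence depths are only bounded by the lengths,
  and the induction is on the total length, which falls even when \<open>S\<close> stays the
  same.\<close>

lemma ex_tree_le_prefix_free:
  assumes "finite S" and "S \<noteq> {}" and "prefix_free_on S C"
  shows "\<exists>t. distinct_leaves t \<and> leaves t = S \<and> (\<forall>a\<in>S. depth t a \<le> length (C a))"
  using assms
proof (induction "\<Sum>a\<in>S. length (C a)" arbitrary: S C rule: less_induct)
  case less
  show ?case
  proof (cases "\<exists>a. S = {a}")
    case True
    then obtain a where "S = {a}" by blast
    then show ?thesis by (intro exI[of _ "Atom a"]) auto
  next
    case False
    \<comment> \<open>An empty codeword would be a prefix of the codeword of any second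
      symbol.\<close>
    have nonempty: "C a \<noteq> []" if "a \<in> S" for a
    proof
      assume "C a = []"
      moreover have "\<exists>b\<in>S. b \<noteq> a"
        using False that by blast
      ultimately show False
        using less.prems(3) that unfolding prefix_free_on_def by (metis Nil_prefix)
    qed
    define R where "R x = {a \<in> S. hd (C a) = x}" for x
    have split: "R True \<union> R False = S" "R True \<inter> R False = {}"
      by (auto simp: R_def)
    have sub: "\<exists>t. distinct_leaves t \<and> leaves t = R x \<and> (\<forall>a\<in>R x. Suc (depth t a) \<le> length (C a))"
      if "R x \<noteq> {}" for x
    proof -
      have le: "(\<Sum>a\<in>R x. length (C a)) \<le> (\<Sum>a\<in>S. length (C a))"
        using less.prems by (intro sum_mono2) (auto simp: R_def)
      have "(\<Sum>a\<in>R x. length (tl (C a))) < (\<Sum>a\<in>R x. length (C a))"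
        using less.prems that nonempty by (intro sum_strict_mono) (auto simp: R_def)
      with le have *: "(\<Sum>a\<in>R x. length (tl (C a))) < (\<Sum>a\<in>S. length (C a))"
        by linarith
      have pf: "prefix_free_on (R x) (\<lambda>a. tl (C a))"
        unfolding prefix_free_on_def
      proof (intro ballI impI notI)
        fix a b assume ab: "a \<in> R x" "b \<in> R x" "a \<noteq> b" "prefix (tl (C a)) (tl (C b))"
        then have "C a = x # tl (C a)" "C b = x # tl (C b)"
          using nonempty unfolding R_def by (metis (mono_tags, lifting) list.collapse mem_Collect_eq)+
        with ab have "prefix (C a) (C b)"
          by (metis Cons_prefix_Cons)
        with ab less.prems show False
          by (auto simp: prefix_free_on_def R_def)
      qed
      have "finite (R x)"
        using less.prems by (simp add: R_def)
      from less.hyps[OF * this that pf] obtain t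
        where t: "distinct_leaves t" "leaves t = R x" "\<forall>a\<in>R x. depth t a \<le> length (tl (C a))"
        by blast
      have "Suc (depth t a) \<le> length (C a)" if "a \<in> R x" for a
      proof -
        have "C a \<noteq> []" "depth t a \<le> length (tl (C a))"
          using t that nonempty by (auto simp: R_def)
        then show ?thesis
          by (cases "C a") auto
      qed
      with t show ?thesis by blast
    qed
    show ?thesis
    proof (cases "R True = {} \<or> R False = {}")
      case True
      then obtain x where "R x = S"
        using split by blast
      with sub[of x] less.prems show ?thesis
        by (metis Suc_leD)
    next
      case False
      with sub obtain k l
        where k: "distinct_leaves k" "leaves k = R True" "\<forall>a\<in>R True. Suc (depth k a) \<le> length (C a)"
          and l: "distinct_leaves l" "leaves l = R False" "\<forall>a\<in>R False. Suc (depth l a) \<le> length (C a)"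
        by meson
      then show ?thesis
        using split by (intro exI[of _ "Merge k l"]) auto
    qed
  qed
qed

lemma ex_distinct_leaves_tree:
  "finite S \<Longrightarrow> S \<noteq> {} \<Longrightarrow> \<exists>t. distinct_leaves t \<and> leaves t = S"
proof (induction S rule: finite_ne_induct)
  case (singleton a)
  show ?case by (rule exI[of _ "Atom a"]) simp
next
  case (insert a S)
  then obtain t where "distinct_leaves t" "leaves t = S" by blast
  with insert show ?case by (intro exI[of _ "Merge (Atom a) t"]) simp
qed

text \<open>Both children of a node have nonempty, disjoint leaf sets, so each is a proper subset of
  \<open>S\<close> and the induction on subsets applies.\<close>

lemma finite_trees: "finite S \<Longrightarrow> finite {t. distinct_leaves t \<and> leaves t = S}"
proof (induction S rule: finite_psubset_induct)
  case (psubset S)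
  define D where "D S = {t. distinct_leaves t \<and> leaves t = S}" for S :: "'a set"
  define E where "E = (\<Union>R\<in>{R. R \<subset> S}. D R)"
  have "D S \<subseteq> Atom ` S \<union> (\<lambda>(k, l). Merge k l) ` (E \<times> E)"
  proof
    fix t assume t: "t \<in> D S"
    show "t \<in> Atom ` S \<union> (\<lambda>(k, l). Merge k l) ` (E \<times> E)"
    proof (cases t)
      case (Merge k l)
      then have "leaves k \<subset> S" "leaves l \<subset> S"
        using t leaves_nonempty[of k] leaves_nonempty[of l]
        by (auto simp: D_def simp del: leaves_nonempty)
      with t Merge have "k \<in> E" "l \<in> E"
        by (auto simp: D_def E_def)
      with Merge show ?thesis by force
    qed (use t in \<open>auto simp: D_def\<close>)
  qed
  moreover have "finite {R. R \<subset> S}"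
    by (rule finite_subset[of _ "Pow S"]) (use psubset.hyps in auto)
  then have "finite E"
    unfolding E_def D_def using psubset.IH by blast
  ultimately have "finite (D S)"
    using psubset.hyps by (elim finite_subset) simp
  then show ?case
    by (simp add: D_def)
qed

section \<open>Redundancy\<close>

lemma minimum_eqI: "is_minimum v S \<Longrightarrow> minimum S = v"
  unfolding minimum_def by (rule the_equality) (auto simp: is_minimum_def intro: antisym)

definition tree_redundancy :: "('a \<Rightarrow> real) \<Rightarrow> 'a sym \<Rightarrow> real" where
  "tree_redundancy q t = cost q t + (\<Sum>a\<in>leaves t. q a * log 2 (q a))"

lemma redundancy_tree_code:
  "distinct_leaves t \<Longrightarrow> dom B = leaves t \<Longrightarrow>
     redundancy (tree_code t) B = tree_redundancy (pr B) t"
  by (simp add: redundancy_def tree_redundancy_def cost_eq_sum)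

text \<open>A source extending \<open>X\<close> together with a tree on its alphabet. The
  probabilities form a total function, so that leaves can be renamed and single weights updated
  without regard to domains.\<close>

definition weighted_tree :: "'a prob_map \<Rightarrow> ('a \<Rightarrow> real) \<Rightarrow> 'a sym \<Rightarrow> bool" where
  "weighted_tree X q t \<longleftrightarrow>
     distinct_leaves t \<and> dom X \<subseteq> leaves t \<and> (\<forall>x\<in>dom X. q x = pr X x) \<and>
     (\<forall>a\<in>leaves t. 0 < q a) \<and> sum q (leaves t) = 1 \<and> 2 \<le> card (leaves t)"

lemma weighted_tree_source:
  assumes "is_source B" and "X \<sqsubseteq> B" and "distinct_leaves t" and "leaves t = dom B"
  shows "weighted_tree X (pr B) t"
proof -
  have "pr B x = pr X x" if "x \<in> dom X" for x
    using assms(2) that by (auto simp: sub_source_def map_le_def)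
  moreover have "dom X \<subseteq> dom B"
    using assms(2) by (simp add: sub_source_def map_le_implies_dom_le)
  ultimately show ?thesis
    using assms by (simp add: weighted_tree_def is_source_def)
qed

lemma ex_source_weighted_tree:
  assumes "weighted_tree X q t"
  shows "\<exists>B. is_source B \<and> X \<sqsubseteq> B \<and> dom B = leaves t \<and>
           redundancy (tree_code t) B = tree_redundancy q t"
proof -
  define B where "B = (\<lambda>a. if a \<in> leaves t then Some (q a) else None)"
  have dom: "dom B = leaves t"
    by (auto simp: B_def dom_def)
  have pr: "pr B a = q a" if "a \<in> leaves t" for a
    using that by (simp add: B_def)
  have "is_source B"
    using assms unfolding is_source_def dom by (auto simp: pr weighted_tree_def)
  moreover have "X \<sqsubseteq> B"
    using assms unfolding sub_source_def map_le_def by (auto simp: B_def weighted_tree_def)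
  moreover have "tree_redundancy (pr B) t = tree_redundancy q t"
    unfolding tree_redundancy_def by (intro arg_cong2[of _ _ _ _ "(+)"] cost_cong sum.cong) (auto simp: pr)
  ultimately show ?thesis
    using assms dom by (auto simp: redundancy_tree_code weighted_tree_def)
qed

text \<open>Every prefix-free code is matched or beaten by a tree, and only finitely many trees have
  the given leaves. So the minimum over infinitely many codes exists and is attained by a
  tree.\<close>

lemma huffman_redundancy_attained:
  assumes "is_source B"
  shows "\<exists>t. distinct_leaves t \<and> leaves t = dom B \<and>
           huffman_redundancy B = redundancy (tree_code t) B"
    and "prefix_free_on (dom B) C \<Longrightarrow> huffman_redundancy B \<le> redundancy C B"
proof -
  let ?T = "{t. distinct_leaves t \<and> leaves t = dom B}" and ?R = "\<lambda>t. redundancy (tree_code t) B"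
  have B: "finite (dom B)" "dom B \<noteq> {}" "\<And>b. b \<in> dom B \<Longrightarrow> 0 \<le> pr B b"
    using assms by (auto simp: is_source_def less_imp_le)
  have shorter: "\<exists>t\<in>?T. ?R t \<le> redundancy C B" if "prefix_free_on (dom B) C" for C
  proof -
    obtain t where "t \<in> ?T" "\<forall>a\<in>dom B. depth t a \<le> length (C a)"
      using ex_tree_le_prefix_free[OF B(1,2) \<open>prefix_free_on (dom B) C\<close>] by auto
    then show ?thesis
      using B(3) unfolding redundancy_def
      by (intro bexI[of _ t]) (auto intro!: sum_mono mult_left_mono)
  qed
  have "?T \<noteq> {}"
    using ex_distinct_leaves_tree[OF B(1,2)] by blast
  have fin: "finite (?R ` ?T)"
    using finite_trees[OF B(1)] by simp
  have "?R ` ?T \<noteq> {}"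
    using \<open>?T \<noteq> {}\<close> by (simp only: image_is_empty not_False_eq_True)
  from Min_in[OF fin this] obtain t where t: "t \<in> ?T" "?R t = Min (?R ` ?T)"
    by (elim imageE) metis
  have least: "?R t \<le> redundancy C B" if "prefix_free_on (dom B) C" for C
  proof -
    from shorter[OF that] obtain t' where "t' \<in> ?T" "?R t' \<le> redundancy C B"
      by blast
    moreover from this have "?R t \<le> ?R t'"
      unfolding t(2) using fin by (intro Min_le imageI)
    ultimately show ?thesis by linarith
  qed
  have "is_minimum (?R t) {redundancy C B |C. prefix_free_on (dom B) C}"
    unfolding is_minimum_def
  proof
    have "prefix_free_on (dom B) (tree_code t)"
      using t(1) prefix_free_tree_code[of t] by auto
    then show "?R t \<in> {redundancy C B |C. prefix_free_on (dom B) C}"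
      by blast
  qed (use least in blast)
  then have "huffman_redundancy B = ?R t"
    unfolding huffman_redundancy_def by (rule minimum_eqI)
  with t least show "\<exists>t. distinct_leaves t \<and> leaves t = dom B \<and>
      huffman_redundancy B = redundancy (tree_code t) B"
    and "prefix_free_on (dom B) C \<Longrightarrow> huffman_redundancy B \<le> redundancy C B" 
    by auto
qed

text \<open>The convex function \<open>x * log 2 x\<close> lies above its tangent at
  \<open>r\<close>. Summed over distributions of equal total mass the linear terms cancel, which
  gives Gibbs' inequality.\<close>

lemma mult_log_tangent:
  fixes x r :: real
  assumes "0 < x" and "0 < r"
  shows "x * log 2 r + (x - r) / ln 2 \<le> x * log 2 x"
proof -
  have "ln (r / x) \<le> r / x - 1"
    using assms by (intro ln_le_minus_one) simp
  then have "x * (ln r - ln x) \<le> x * (r / x - 1)"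
    using assms by (intro mult_left_mono) (simp_all add: ln_div)
  then have "x * ln r + (x - r) \<le> x * ln x"
    using assms by (simp add: algebra_simps)
  then have "(x * ln r + (x - r)) / ln 2 \<le> (x * ln x) / ln 2"
    by (intro divide_right_mono) simp_all
  then show ?thesis
    by (simp add: log_def add_divide_distrib)
qed

text \<open>Two tangents at the mean of \<open>x\<close> and \<open>y\<close>, whose linear terms
  cancel. Divided by \<open>x + y\<close>, this says that the binary entropy is at most 1.\<close>

lemma mult_log_add_le:
  fixes x y :: real
  assumes "0 < x" and "0 < y"
  shows "(x + y) * log 2 (x + y) \<le> x * log 2 x + y * log 2 y + (x + y)"
proof -
  let ?r = "(x + y) / 2"
  have "log 2 ?r = log 2 (x + y) - 1"
    using assms by (simp add: log_divide)
  moreover have "(x - ?r) / ln 2 + (y - ?r) / ln 2 = 0"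
    by (simp add: add_divide_distrib[symmetric])
  moreover have "x * log 2 ?r + (x - ?r) / ln 2 \<le> x * log 2 x"
    "y * log 2 ?r + (y - ?r) / ln 2 \<le> y * log 2 y"
    using assms by (auto intro!: mult_log_tangent)
  ultimately have "x * (log 2 (x + y) - 1) + y * (log 2 (x + y) - 1) \<le> x * log 2 x + y * log 2 y"
    by simp
  then show ?thesis
    by (simp add: algebra_simps)
qed

text \<open>By Gibbs' inequality the best probabilities for the symbols outside \<open>X\<close> are
  proportional to \<open>2 powr - l\<close>, where \<open>l\<close> is the codeword length.\<close>

lemma redundancy_minimum_attained:
  fixes C :: "'a code"
  assumes B0: "is_source B0" "X \<sqsubseteq> B0" "dom B0 = S"
  shows "\<exists>M. is_source M \<and> X \<sqsubseteq> M \<and> dom M = S \<and>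
           (\<forall>B. is_source B \<and> X \<sqsubseteq> B \<and> dom B = S \<longrightarrow> redundancy C M \<le> redundancy C B)"
proof (cases "S \<subseteq> dom X")
  case True
  \<comment> \<open>Without new symbols there is nothing to choose: \<open>X\<close> is the only
    source on \<open>S\<close>.\<close>
  have "B = X" if "X \<sqsubseteq> B" "dom B = S" for B
  proof
    fix a show "B a = X a"
    proof (cases "a \<in> dom X")
      case False
      with True that have "a \<notin> dom B" by auto
      with False show ?thesis by (simp add: domIff)
    qed (use that in \<open>auto simp: sub_source_def map_le_def\<close>)
  qed
  with B0 show ?thesis by blast
next
  case False
  define U where "U = S - dom X"
  define l where "l a = real (length (C a))" for a
  \<comment> \<open>\<open>Q\<close> is the mass that every source extending \<open>X\<close> on the
    alphabet \<open>S\<close> leaves to the new symbols; \<open>Z\<close> normalises the weights to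
    that mass.\<close>
  define Q where "Q = (\<Sum>a\<in>U. pr B0 a)"
  define Z where "Z = (\<Sum>a\<in>U. 2 powr - l a)"
  define r where "r a = Q / Z * 2 powr - l a" for a
  define M where "M a = (if a \<in> U then Some (r a) else X a)" for a
  have U: "finite U" "U \<noteq> {}" "S = dom X \<union> U" "dom X \<inter> U = {}"
    using B0 False by (auto simp: U_def is_source_def sub_source_def dest: map_le_implies_dom_le)
  have finX: "finite (dom X)"
    using B0 U by (simp add: is_source_def)
  have split: "sum f S = sum f (dom X) + sum f U" for f :: "'a \<Rightarrow> real"
    using U finX by (simp add: sum.union_disjoint)
  have pr: "pr B x = pr X x" if "X \<sqsubseteq> B" "x \<in> dom X" for B x
    using that by (auto simp: sub_source_def map_le_def)
  have sumX: "(\<Sum>x\<in>dom X. f x (pr B x)) = (\<Sum>x\<in>dom X. f x (pr X x))"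
    if "X \<sqsubseteq> B" for B and f :: "'a \<Rightarrow> real \<Rightarrow> real"
    using pr[OF that] by simp
  have sumU: "(\<Sum>a\<in>U. pr B a) = Q" if "is_source B" "X \<sqsubseteq> B" "dom B = S" for B
  proof -
    have "(\<Sum>a\<in>dom B. pr B a) = 1" "(\<Sum>a\<in>dom B0. pr B0 a) = 1"
      using that B0 by (simp_all add: is_source_def)
    then show ?thesis
      using sumX[OF that(2), of "\<lambda>_ p. p"] sumX[OF B0(2), of "\<lambda>_ p. p"] that B0
      by (simp add: split Q_def)
  qed
  have pos: "0 < pr B a" if "is_source B" "dom B = S" "a \<in> U" for B a
    using that U by (simp add: is_source_def)
  have "0 < Q" "0 < Z"
    unfolding Q_def Z_def using U pos[OF B0(1,3)] by (auto intro!: sum_pos)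
  then have r: "0 < r a" for a
    by (simp add: r_def)
  have "sum r U = Q / Z * Z"
    unfolding r_def Z_def sum_distrib_left ..
  then have sum_r: "sum r U = Q"
    using \<open>0 < Z\<close> by simp
  have log_r: "log 2 (r a) = log 2 (Q / Z) - l a" for a
    using \<open>0 < Q\<close> \<open>0 < Z\<close> unfolding r_def by (subst log_mult) simp_all
  have domM: "dom M = S"
    using U by (auto simp: M_def dom_def)
  have prM: "pr M a = r a" if "a \<in> U" for a
    using that by (simp add: M_def)
  have subM: "X \<sqsubseteq> M"
    using U by (auto simp: sub_source_def map_le_def M_def)
  have "is_source M"
  proof -
    have "0 < pr M a" if "a \<in> S" for a
    proof (cases "a \<in> U")
      case False
      with that U have "a \<in> dom X"
        by blast
      then have "pr M a = pr B0 a"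
        using pr[OF subM] pr[OF B0(2)] by simp
      then show ?thesis
        using B0 \<open>a \<in> S\<close> by (simp add: is_source_def)
    qed (simp add: prM r)
    moreover have "(\<Sum>a\<in>S. pr M a) = (\<Sum>a\<in>S. pr B0 a)"
      using sumX[OF subM, of "\<lambda>_ p. p"] sumX[OF B0(2), of "\<lambda>_ p. p"] sum_r
      by (simp add: split prM Q_def)
    ultimately show ?thesis
      using B0 unfolding is_source_def domM by simp
  qed
  define G where "G B = (\<Sum>a\<in>U. pr B a * l a + pr B a * log 2 (pr B a))" for B :: "'a prob_map"
  have red: "redundancy C B = (\<Sum>x\<in>dom X. pr X x * l x + pr X x * log 2 (pr X x)) + G B"
    if "X \<sqsubseteq> B" "dom B = S" for B
    using sumX[OF that(1), of "\<lambda>x p. p * l x + p * log 2 p"] that(2)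
    by (simp add: redundancy_def split G_def sum.distrib l_def)
  \<comment> \<open>For the candidate, \<open>l a + log 2 (r a)\<close> is the same for all new
    symbols.\<close>
  have "G M = (\<Sum>a\<in>U. r a * log 2 (Q / Z))"
    unfolding G_def by (intro sum.cong) (simp_all add: prM log_r algebra_simps)
  then have GM: "G M = Q * log 2 (Q / Z)"
    by (simp add: sum_distrib_right[symmetric] sum_r)
  have "redundancy C M \<le> redundancy C B" if B: "is_source B" "X \<sqsubseteq> B" "dom B = S" for B
  proof -
    \<comment> \<open>The added terms \<open>(pr B a - r a) / ln 2\<close> sum to zero, as both
      distributions have mass \<open>Q\<close> on \<open>U\<close>.\<close>
    have "Q * log 2 (Q / Z) = (\<Sum>a\<in>U. pr B a * log 2 (Q / Z) + (pr B a - r a) / ln 2)"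
      using sumU[OF B] sum_r
      by (simp add: sum.distrib sum_distrib_right[symmetric] sum_divide_distrib[symmetric] sum_subtractf)
    also have "\<dots> \<le> G B"
      unfolding G_def
    proof (rule sum_mono)
      fix a assume "a \<in> U"
      then show "pr B a * log 2 (Q / Z) + (pr B a - r a) / ln 2
          \<le> pr B a * l a + pr B a * log 2 (pr B a)"
        using mult_log_tangent[OF pos[OF B(1,3)] r, of a a] by (simp add: log_r algebra_simps)
    qed
    finally show ?thesis
      using red[OF B(2,3)] red[OF subM domM] GM by simp
  qed
  with \<open>is_source M\<close> subM domM show ?thesis by blast
qed

lemma code_bound_attained:
  assumes "is_source B0" "X \<sqsubseteq> B0" "dom B0 = S"
  shows "\<exists>M. is_source M \<and> X \<sqsubseteq> M \<and> dom M = S \<and> code_bound X S C = ereal (redundancy C M)"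
    and "code_bound X S C \<le> ereal (redundancy C B0)"
proof -
  let ?Bs = "{B. is_source B \<and> X \<sqsubseteq> B \<and> dom B = S}"
  obtain M where M: "M \<in> ?Bs" "\<forall>B\<in>?Bs. redundancy C M \<le> redundancy C B"
    using redundancy_minimum_attained[OF assms, of C] by blast
  then have "minimum (redundancy C ` ?Bs) = redundancy C M"
    by (intro minimum_eqI) (auto simp: is_minimum_def)
  moreover have "?Bs \<noteq> {}"
    using assms by blast
  ultimately have *: "code_bound X S C = ereal (redundancy C M)"
    by (simp add: code_bound_def Let_def)
  with M show "\<exists>M. is_source M \<and> X \<sqsubseteq> M \<and> dom M = S \<and> code_bound X S C = ereal (redundancy C M)"
    by blast
  show "code_bound X S C \<le> ereal (redundancy C B0)"
    using * M assms by simp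
qed

section \<open>Forests\<close>

definition forest :: "'a sym set \<Rightarrow> bool" where
  "forest K \<longleftrightarrow> finite K \<and> (\<forall>k\<in>K. distinct_leaves k) \<and>
     (\<forall>k\<in>K. \<forall>l\<in>K. k \<noteq> l \<longrightarrow> leaves k \<inter> leaves l = {})"

text \<open>\<open>Merge a b\<close> shares leaves with \<open>a\<close> and so cannot already be in
  \<open>K\<close>. Therefore the number of symbols drops by exactly one, and the merged symbol can
  serve as the fresh leaf of the greedy choice.\<close>

lemma forest_merge:
  assumes "forest K" and "a \<in> K" "b \<in> K" "a \<noteq> b"
  shows "Merge a b \<notin> K" and "forest (insert (Merge a b) (K - {a, b}))"
    and "\<Union>(leaves ` insert (Merge a b) (K - {a, b})) = \<Union>(leaves ` K)"
    and "card (insert (Merge a b) (K - {a, b})) + 1 = card K"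
proof -
  have ab: "distinct_leaves a" "distinct_leaves b" "leaves a \<inter> leaves b = {}" "finite K"
    using assms by (auto simp: forest_def)
  show notin: "Merge a b \<notin> K"
  proof
    assume "Merge a b \<in> K"
    moreover have "Merge a b \<noteq> a"
      using ab leaves_nonempty[of b] by (metis Int_absorb1 Un_upper2 leaves.simps(2))
    ultimately have "leaves (Merge a b) \<inter> leaves a = {}"
      using assms unfolding forest_def by blast
    then show False
      using leaves_nonempty[of a] by (simp add: Int_Un_distrib2)
  qed
  have "leaves m \<inter> leaves (Merge a b) = {}" if "m \<in> K - {a, b}" for m
  proof -
    have "leaves m \<inter> leaves a = {}" "leaves m \<inter> leaves b = {}"
      using that assms unfolding forest_def by blast+
    then show ?thesis by auto
  qed
  then show "forest (insert (Merge a b) (K - {a, b}))"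
    using assms(1) ab unfolding forest_def by (auto simp: Int_commute)
  show "\<Union>(leaves ` insert (Merge a b) (K - {a, b})) = \<Union>(leaves ` K)"
    using assms by auto
  have "card (K - {a, b}) = card K - 2"
    using assms ab by (simp add: card_Diff_subset)
  moreover have "card {a, b} \<le> card K"
    using assms ab by (intro card_mono) auto
  ultimately show "card (insert (Merge a b) (K - {a, b})) + 1 = card K"
    using assms ab notin by simp
qed

lemma forest_subset: "forest K \<Longrightarrow> L \<subseteq> K \<Longrightarrow> forest L"
  unfolding forest_def by (meson finite_subset subsetD)

lemma forest_insert_Atom:
  "forest K \<Longrightarrow> a \<notin> \<Union>(leaves ` K) \<Longrightarrow> forest (insert (Atom a) K)"
  by (auto simp: forest_def)

lemma forest_Un_Atoms:
  assumes "forest K" and "finite A" and "A \<inter> \<Union>(leaves ` K) = {}"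
  shows "forest (K \<union> Atom ` A)"
  unfolding forest_def
proof (intro conjI ballI impI)
  fix k l assume "k \<in> K \<union> Atom ` A" "l \<in> K \<union> Atom ` A" "k \<noteq> l"
  moreover have "a \<notin> leaves m" if "m \<in> K" "a \<in> A" for m a
    using assms that by blast
  moreover have "leaves k \<inter> leaves l = {}" if "k \<in> K" "l \<in> K"
    using assms(1) \<open>k \<noteq> l\<close> that by (simp add: forest_def)
  ultimately show "leaves k \<inter> leaves l = {}"
    by auto
qed (use assms in \<open>auto simp: forest_def\<close>)

section \<open>Trees whose leaves are trees\<close>

primrec flat :: "'a sym sym \<Rightarrow> 'a sym" where
  "flat (Atom k) = k"
| "flat (Merge k l) = Merge (flat k) (flat l)"

lemma flat_map_Atom: "flat (map_sym Atom t) = t"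
  by (induction t) auto

lemma leaves_flat: "leaves (flat t) = \<Union>(leaves ` leaves t)"
  by (induction t) auto

lemma sym_prob_flat: "sym_prob q (flat t) = sym_prob (sym_prob q) t"
  by (induction t) auto

lemma distinct_leaves_flat:
  "distinct_leaves t \<Longrightarrow> forest (leaves t) \<Longrightarrow> distinct_leaves (flat t)"
proof (induction t)
  case (Merge k l)
  then have "forest (leaves k)" "forest (leaves l)"
    by (auto elim: forest_subset)
  moreover have "leaves x \<inter> leaves y = {}" if "x \<in> leaves k" "y \<in> leaves l" for x y
  proof -
    have "x \<noteq> y"
      using Merge.prems that by auto
    then show ?thesis
      using Merge.prems that unfolding forest_def by simp
  qed
  ultimately show ?case
    using Merge by (auto simp: leaves_flat)
qed (simp add: forest_def)

text \<open>The outer tree accounts for the merges still to be made, its leaves for those already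
  made.\<close>

lemma cost_flat:
  "distinct_leaves t \<Longrightarrow> cost q (flat t) = cost (sym_prob q) t + (\<Sum>k\<in>leaves t. cost q k)"
  by (induction t) (auto simp: sum.union_disjoint sym_prob_flat)

text \<open>The greedy choice on the outer tree, with the merged symbol itself as the contracted
  leaf. \<open>sym_prob q\<close> already gives it the right weight, and the cost of the merge moves
  from the outer tree into the new leaf.\<close>

lemma greedy_merge:
  assumes T: "distinct_leaves T" "forest (leaves T)"
    and ab: "a \<in> leaves T" "b \<in> leaves T" "a \<noteq> b"
    and least: "\<And>c. c \<in> leaves T - {a, b} \<Longrightarrow>
      sym_prob q a \<le> sym_prob q c \<and> sym_prob q b \<le> sym_prob q c"
  shows "\<exists>T'. distinct_leaves T' \<and> leaves T' = insert (Merge a b) (leaves T - {a, b}) \<and>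
           cost q (flat T') \<le> cost q (flat T)"
proof -
  have z: "Merge a b \<notin> leaves T"
    by (rule forest_merge(1)[OF T(2) ab])
  obtain T' where T': "distinct_leaves T'" "leaves T' = insert (Merge a b) (leaves T - {a, b})"
    and *: "cost ((sym_prob q)(Merge a b := sym_prob q a + sym_prob q b)) T'
       + sym_prob q a + sym_prob q b \<le> cost (sym_prob q) T"
    using greedy_choice[OF T(1) ab z least] by blast
  have "(sym_prob q)(Merge a b := sym_prob q a + sym_prob q b) = sym_prob q"
    by (simp add: fun_eq_iff)
  with * have "cost (sym_prob q) T' + sym_prob q a + sym_prob q b \<le> cost (sym_prob q) T"
    by simp
  moreover have "(\<Sum>k\<in>leaves T'. cost q k) =
      (\<Sum>k\<in>leaves T - {a, b}. cost q k) + cost q (Merge a b)"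
    using T'(2) z by simp
  moreover have "(\<Sum>k\<in>leaves T. cost q k) = (\<Sum>k\<in>leaves T - {a, b}. cost q k) + (cost q a + cost q b)"
    using ab by (subst sum.subset_diff[of "{a, b}"]) auto
  ultimately show ?thesis
    using T' T(1) by (intro exI[of _ T']) (simp add: cost_flat)
qed

text \<open>Here the contracted pair becomes an elementary symbol \<open>v\<close> instead of a
  merged one. The weights change to a different source, and the cost \<open>q a + q b\<close> of the
  merge disappears.\<close>

lemma greedy_replace:
  assumes T: "distinct_leaves T" "forest (leaves T)"
    and ab: "Atom a \<in> leaves T" "Atom b \<in> leaves T" "a \<noteq> b"
    and least: "\<And>c. c \<in> leaves T - {Atom a, Atom b} \<Longrightarrow>
      q a \<le> sym_prob q c \<and> q b \<le> sym_prob q c"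
    and v: "v \<notin> \<Union>(leaves ` leaves T)"
  shows "\<exists>T'. distinct_leaves T' \<and> leaves T' = insert (Atom v) (leaves T - {Atom a, Atom b}) \<and>
           cost (q(v := q a + q b)) (flat T') + q a + q b \<le> cost q (flat T)"
proof -
  let ?q = "q(v := q a + q b)" and ?w = "(sym_prob q)(Atom v := q a + q b)"
  have z: "Atom v \<notin> leaves T"
    using v by fastforce
  obtain T' where T': "distinct_leaves T'" "leaves T' = insert (Atom v) (leaves T - {Atom a, Atom b})"
    and *: "cost ?w T' + q a + q b \<le> cost (sym_prob q) T"
    using greedy_choice[OF T(1) ab(1,2) _ z, of "sym_prob q"] ab(3) least by auto
  have old: "sym_prob ?q k = sym_prob q k" "cost ?q k = cost q k" if "k \<in> leaves T" for k
    using that v by (auto intro!: sym_prob_cong cost_cong)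
  have "cost (sym_prob ?q) T' = cost ?w T'"
    using old z T'(2) by (intro cost_cong) auto
  moreover have "(\<Sum>k\<in>leaves T'. cost ?q k) = (\<Sum>k\<in>leaves T - {Atom a, Atom b}. cost q k)"
    using T'(2) z old by simp
  moreover have "(\<Sum>k\<in>leaves T. cost q k) = (\<Sum>k\<in>leaves T - {Atom a, Atom b}. cost q k)"
    using ab by (subst sum.subset_diff[of "{Atom a, Atom b}"]) auto
  ultimately show ?thesis
    using T' T(1) * by (intro exI[of _ T']) (simp add: cost_flat)
qed

lemma weighted_tree_map_sym:
  assumes t: "weighted_tree X r t" and inj: "inj_on f (leaves t)"
    and X: "\<And>x. x \<in> dom X \<Longrightarrow> f x = x" and q: "\<And>a. a \<in> leaves t \<Longrightarrow> q (f a) = r a"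
  shows "weighted_tree X q (map_sym f t)" and "tree_redundancy q (map_sym f t) = tree_redundancy r t"
proof -
  have "dom X \<subseteq> f ` leaves t"
  proof
    fix x assume "x \<in> dom X"
    then have "x \<in> leaves t" "f x = x"
      using t X by (auto simp: weighted_tree_def)
    then show "x \<in> f ` leaves t" by (metis imageI)
  qed
  moreover have "q x = pr X x" if "x \<in> dom X" for x
    using t q[of x] X[OF that] that by (auto simp: weighted_tree_def)
  ultimately show "weighted_tree X q (map_sym f t)"
    using t inj q unfolding weighted_tree_def
    by (auto simp: distinct_leaves_map_sym sum.reindex card_image)
  show "tree_redundancy q (map_sym f t) = tree_redundancy r t"
    using inj q unfolding tree_redundancy_def cost_map_sym
    by (auto simp: sum.reindex intro!: arg_cong2[of _ _ _ _ "(+)"] cost_cong)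
qed

section \<open>Reachable states\<close>

text \<open>\<open>merge_old\<close> and \<open>merge_new\<close> are the results of
  \<open>step_a\<close> and \<open>step_b\<close> stated through symbols in place of their numbers.
  The order of \<open>k\<close> and \<open>l\<close> remains visible, since \<open>Merge k l\<close>
  and \<open>Merge l k\<close> differ.\<close>

definition merge_old :: "(nat \<Rightarrow> 'a) \<Rightarrow> 'a ext_state \<Rightarrow> 'a sym \<Rightarrow> 'a sym \<Rightarrow> 'a ext_state" where
  "merge_old u \<Theta> k l =
     State (insert (Merge k l) (symbols \<Theta> - {k, l})) (index \<Theta>)
       (ineqs \<Theta> \<union> Leq k ` (symbols \<Theta> - {l}) \<union> Leq l ` (symbols \<Theta> - {k}) \<union>
        {Leq k (Atom (u (index \<Theta>))), Leq l (Atom (u (index \<Theta>)))})"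

definition merge_new :: "(nat \<Rightarrow> 'a) \<Rightarrow> 'a ext_state \<Rightarrow> 'a sym \<Rightarrow> 'a ext_state" where
  "merge_new u \<Theta> k =
     State (insert (Merge k (Atom (u (index \<Theta>)))) (symbols \<Theta> - {k})) (Suc (index \<Theta>))
       (ineqs \<Theta> \<union> Leq k ` symbols \<Theta> \<union> Leq (Atom (u (index \<Theta>))) ` (symbols \<Theta> - {k}) \<union>
        {Leq k (Atom (u (Suc (index \<Theta>)))), Leq (Atom (u (index \<Theta>))) (Atom (u (Suc (index \<Theta>))))})"

locale enumeration_input =
  fixes X :: "'a prob_map" and u :: "nat \<Rightarrow> 'a" and \<kappa> :: "'a sym set \<Rightarrow> nat \<Rightarrow> 'a sym"
  assumes finite_X: "finite (dom X)" and X_nonempty: "dom X \<noteq> {}"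
    and X_pos: "\<And>x. x \<in> dom X \<Longrightarrow> 0 < pr X x"
    and inj_u: "inj u" and u_X: "range u \<inter> dom X = {}"
    and numbering: "is_numbering \<kappa>"
begin

text \<open>For natural \<open>s\<close>, the guard of \<open>step_b\<close> is
  \<open>s < max_new\<close>, also if the integer difference were negative.\<close>

definition max_new :: nat where
  "max_new = nat (size_bound X - int (card (dom X)))"

definition reached :: "nat \<Rightarrow> 'a ext_state set" where
  "reached i = (next_states u \<kappa> X ^^ i) {State (Atom ` dom X) 0 {Nonneg (Atom (u 0))}}"

lemma u_eq_iff [simp]: "u i = u j \<longleftrightarrow> i = j"
  using inj_u by (auto dest: injD)

lemma u_notin_X [simp]: "u i \<notin> dom X"
  using u_X by auto

lemma kappa_bij: "finite K \<Longrightarrow> bij_betw (\<kappa> K) {1..card K} K"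
  using numbering by (auto simp: is_numbering_def)

lemma kappa_image:
  assumes "finite K" and "i \<in> {1..card K}"
  shows "{f (\<kappa> K l) |l. l \<in> {1..card K}} = f ` K"
    and "{f (\<kappa> K l) |l. l \<in> {1..card K} \<and> l \<noteq> i} = f ` (K - {\<kappa> K i})"
proof -
  have inj: "inj_on (\<kappa> K) {1..card K}" and img: "\<kappa> K ` {1..card K} = K"
    using kappa_bij[OF assms(1)] by (auto simp: bij_betw_def)
  have "{f (\<kappa> K l) |l. l \<in> {1..card K}} = f ` \<kappa> K ` {1..card K}"
    by auto
  then show "{f (\<kappa> K l) |l. l \<in> {1..card K}} = f ` K"
    unfolding img .
  have "{f (\<kappa> K l) |l. l \<in> {1..card K} \<and> l \<noteq> i} = f ` \<kappa> K ` ({1..card K} - {i})"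
    by auto
  also have "\<kappa> K ` ({1..card K} - {i}) = K - {\<kappa> K i}"
    using assms(2) img by (subst inj_on_image_set_diff[OF inj]) auto
  finally show "{f (\<kappa> K l) |l. l \<in> {1..card K} \<and> l \<noteq> i} = f ` (K - {\<kappa> K i})" .
qed

lemma step_a_eq:
  assumes "finite (symbols \<Theta>)" "i \<in> {1..card (symbols \<Theta>)}" "j \<in> {1..card (symbols \<Theta>)}"
  shows "step_a u \<kappa> \<Theta> i j = merge_old u \<Theta> (\<kappa> (symbols \<Theta>) i) (\<kappa> (symbols \<Theta>) j)"
  unfolding step_a_def merge_old_def Let_def
    kappa_image(2)[OF assms(1,2)] kappa_image(2)[OF assms(1,3)]
  by simp

lemma step_b_eq:
  assumes "finite (symbols \<Theta>)" "i \<in> {1..card (symbols \<Theta>)}"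
  shows "step_b u \<kappa> \<Theta> i = merge_new u \<Theta> (\<kappa> (symbols \<Theta>) i)"
  unfolding step_b_def merge_new_def Let_def kappa_image[OF assms] by simp

lemma next_states_cases [consumes 2, case_names old new]:
  assumes "\<Theta>' \<in> next_states u \<kappa> X \<Phi>" and fin: "\<forall>\<Theta>\<in>\<Phi>. finite (symbols \<Theta>)"
  obtains (old) \<Theta> k l where "\<Theta> \<in> \<Phi>" "k \<in> symbols \<Theta>" "l \<in> symbols \<Theta>" "k \<noteq> l" "\<Theta>' = merge_old u \<Theta> k l"
  | (new) \<Theta> k where "\<Theta> \<in> \<Phi>" "k \<in> symbols \<Theta>" "index \<Theta> < max_new" "\<Theta>' = merge_new u \<Theta> k"
proof -
  consider (a) \<Theta> j k where "\<Theta> \<in> \<Phi>" "1 \<le> j" "j < k" "k \<le> card (symbols \<Theta>)" "\<Theta>' = step_a u \<kappa> \<Theta> j k"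
    | (b) \<Theta> j where "\<Theta> \<in> \<Phi>" "1 \<le> j" "j \<le> card (symbols \<Theta>)"
        "int (card (dom X)) + int (index \<Theta>) < size_bound X" "\<Theta>' = step_b u \<kappa> \<Theta> j"
    using assms(1) unfolding next_states_def Let_def by blast
  then show thesis
  proof cases
    case a
    let ?K = "symbols \<Theta>"
    have "bij_betw (\<kappa> ?K) {1..card ?K} ?K"
      using a fin kappa_bij by blast
    moreover have "j \<in> {1..card ?K}" "k \<in> {1..card ?K}" "j \<noteq> k"
      using a by auto
    ultimately have "\<kappa> ?K j \<in> ?K" "\<kappa> ?K k \<in> ?K" "\<kappa> ?K j \<noteq> \<kappa> ?K k"
      by (auto simp: bij_betw_apply bij_betw_def inj_on_eq_iff)
    with a show thesis
      using old[of \<Theta>] step_a_eq[of \<Theta> j k] fin by auto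
  next
    case b
    let ?K = "symbols \<Theta>"
    have "\<kappa> ?K j \<in> ?K"
      using b fin kappa_bij[of ?K] by (auto simp: bij_betw_apply)
    moreover have "index \<Theta> < max_new"
      using b unfolding max_new_def by linarith
    ultimately show thesis
      using b new[of \<Theta>] step_b_eq[of \<Theta> j] fin by auto
  qed
qed

text \<open>Only pairs of numbers with \<open>j < k\<close> are merged, so the numbering decides
  which of the two orientations is produced; both are therefore assumed consistent.\<close>

lemma merge_old_next_states:
  assumes "\<Theta> \<in> \<Phi>" and fin: "finite (symbols \<Theta>)" and kl: "k \<in> symbols \<Theta>" "l \<in> symbols \<Theta>" "k \<noteq> l"
    and con: "consistent u X (merge_old u \<Theta> k l)" "consistent u X (merge_old u \<Theta> l k)"
  shows "merge_old u \<Theta> k l \<in> next_states u \<kappa> X \<Phi> \<or> merge_old u \<Theta> l k \<in> next_states u \<kappa> X \<Phi>"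
proof -
  let ?K = "symbols \<Theta>"
  obtain i j where i: "i \<in> {1..card ?K}" "k = \<kappa> ?K i" and j: "j \<in> {1..card ?K}" "l = \<kappa> ?K j"
    using kappa_bij[OF fin] kl(1,2) unfolding bij_betw_def by blast
  have "merge_old u \<Theta> k l = step_a u \<kappa> \<Theta> i j" "merge_old u \<Theta> l k = step_a u \<kappa> \<Theta> j i"
    using i j fin by (simp_all add: step_a_eq)
  moreover have "i < j \<or> j < i"
    using i j kl(3) by (cases i j rule: linorder_cases) auto
  ultimately show ?thesis
    using i j con assms(1) unfolding next_states_def Let_def by fastforce
qed

lemma merge_new_next_states:
  assumes "\<Theta> \<in> \<Phi>" and fin: "finite (symbols \<Theta>)" and k: "k \<in> symbols \<Theta>"
    and con: "consistent u X (merge_new u \<Theta> k)" and "index \<Theta> < max_new"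
  shows "merge_new u \<Theta> k \<in> next_states u \<kappa> X \<Phi>"
proof -
  let ?K = "symbols \<Theta>"
  obtain i where i: "i \<in> {1..card ?K}" "k = \<kappa> ?K i"
    using kappa_bij[OF fin] k unfolding bij_betw_def by blast
  have "merge_new u \<Theta> k = step_b u \<kappa> \<Theta> i"
    using i fin by (simp add: step_b_eq)
  moreover have "int (card (dom X)) + int (index \<Theta>) < size_bound X"
    using assms(5) unfolding max_new_def by linarith
  ultimately show ?thesis
    using i con assms(1) unfolding next_states_def Let_def by fastforce
qed

text \<open>New symbols enter only by merging with a symbol already present, so every symbol keeps a
  leaf in \<open>X\<close>. This makes it at least as probable as the least symbol of
  \<open>X\<close>.\<close>

definition well_formed :: "'a ext_state \<Rightarrow> bool" where
  "well_formed \<Theta> \<longleftrightarrow> forest (symbols \<Theta>) \<and> symbols \<Theta> \<noteq> {} \<and>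
     \<Union>(leaves ` symbols \<Theta>) = dom X \<union> u ` {..<index \<Theta>} \<and>
     (\<forall>k\<in>symbols \<Theta>. leaves k \<inter> dom X \<noteq> {})"

lemma well_formed_merge_old:
  assumes "well_formed \<Theta>" and "k \<in> symbols \<Theta>" "l \<in> symbols \<Theta>" "k \<noteq> l"
  shows "well_formed (merge_old u \<Theta> k l)"
    and "card (symbols (merge_old u \<Theta> k l)) + 1 = card (symbols \<Theta>)"
proof -
  have "forest (symbols \<Theta>)"
    using assms by (simp add: well_formed_def)
  note m = forest_merge[OF this assms(2-4)]
  show "well_formed (merge_old u \<Theta> k l)"
    unfolding well_formed_def merge_old_def ext_state.sel
  proof (intro conjI)
    show "\<Union>(leaves ` insert (Merge k l) (symbols \<Theta> - {k, l})) = dom X \<union> u ` {..<index \<Theta>}"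
      using m(3) assms(1) unfolding well_formed_def by (rule trans[OF _ conjunct1[OF conjunct2[OF conjunct2]]])
    have "\<forall>m\<in>symbols \<Theta>. leaves m \<inter> dom X \<noteq> {}"
      using assms(1) by (simp add: well_formed_def)
    with assms(2) show "\<forall>m\<in>insert (Merge k l) (symbols \<Theta> - {k, l}). leaves m \<inter> dom X \<noteq> {}"
      by (simp add: Int_Un_distrib2)
  qed (use m in auto)
  show "card (symbols (merge_old u \<Theta> k l)) + 1 = card (symbols \<Theta>)"
    using m(4) by (simp add: merge_old_def)
qed

lemma Atom_u_notin:
  assumes "well_formed \<Theta>" and "index \<Theta> \<le> i"
  shows "u i \<notin> \<Union>(leaves ` symbols \<Theta>)" "Atom (u i) \<notin> symbols \<Theta>"
proof -
  have *: "\<Union>(leaves ` symbols \<Theta>) = dom X \<union> u ` {..<index \<Theta>}"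
    using assms(1) by (simp add: well_formed_def)
  show "u i \<notin> \<Union>(leaves ` symbols \<Theta>)"
    unfolding * using assms(2) by auto
  then show "Atom (u i) \<notin> symbols \<Theta>"
    by fastforce
qed

text \<open>With the next new symbol first added as a tree of one leaf, the step is an ordinary
  merge in the enlarged forest.\<close>

lemma well_formed_merge_new:
  assumes "well_formed \<Theta>" and "k \<in> symbols \<Theta>"
  shows "well_formed (merge_new u \<Theta> k)"
    and "card (symbols (merge_new u \<Theta> k)) = card (symbols \<Theta>)"
proof -
  let ?a = "Atom (u (index \<Theta>))" and ?K = "symbols \<Theta>"
  have wf: "forest ?K" "\<Union>(leaves ` ?K) = dom X \<union> u ` {..<index \<Theta>}"
    "\<And>m. m \<in> ?K \<Longrightarrow> leaves m \<inter> dom X \<noteq> {}"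
    using assms(1) by (simp_all add: well_formed_def)
  have a: "?a \<notin> ?K" "u (index \<Theta>) \<notin> \<Union>(leaves ` ?K)"
    using Atom_u_notin[OF assms(1)] by auto
  have "forest (insert ?a ?K)"
    using wf(1) a(2) by (rule forest_insert_Atom)
  moreover have "k \<noteq> ?a"
    using a assms(2) by auto
  ultimately have m: "forest (insert (Merge k ?a) (insert ?a ?K - {k, ?a}))"
    "\<Union>(leaves ` insert (Merge k ?a) (insert ?a ?K - {k, ?a})) = \<Union>(leaves ` insert ?a ?K)"
    "card (insert (Merge k ?a) (insert ?a ?K - {k, ?a})) + 1 = card (insert ?a ?K)"
    using forest_merge[of "insert ?a ?K" k ?a] assms(2) by auto
  have eq: "insert ?a ?K - {k, ?a} = ?K - {k}"
    using a by auto
  show "well_formed (merge_new u \<Theta> k)"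
    unfolding well_formed_def merge_new_def ext_state.sel
  proof (intro conjI)
    show "forest (insert (Merge k ?a) (?K - {k}))"
      using m(1) unfolding eq .
    show "\<Union>(leaves ` insert (Merge k ?a) (?K - {k})) = dom X \<union> u ` {..<Suc (index \<Theta>)}"
      using m(2) wf(2) unfolding eq by (simp add: lessThan_Suc)
    show "\<forall>m\<in>insert (Merge k ?a) (?K - {k}). leaves m \<inter> dom X \<noteq> {}"
      using wf(3) assms(2) by auto
  qed auto
  show "card (symbols (merge_new u \<Theta> k)) = card ?K"
    using m(3) a wf(1) unfolding eq by (simp add: merge_new_def forest_def)
qed

text \<open>Each transition uses up either one symbol or one of the \<open>max_new\<close>
  admissible new symbols. The exact count bounds the number of rounds.\<close>

lemma well_formed_reached:
  "\<Theta> \<in> reached i \<Longrightarrow> well_formed \<Theta> \<and> index \<Theta> \<le> max_new \<and>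
     card (symbols \<Theta>) + (max_new - index \<Theta>) + i = card (dom X) + max_new"
proof (induction i arbitrary: \<Theta>)
  case 0
  have "forest (Atom ` dom X)"
    using finite_X by (auto simp: forest_def)
  moreover have "card (Atom ` dom X) = card (dom X)"
    by (intro card_image) (simp add: inj_on_def)
  ultimately show ?case
    using 0 X_nonempty by (auto simp: reached_def well_formed_def)
next
  case (Suc i)
  have "\<Theta> \<in> next_states u \<kappa> X (reached i)"
    using Suc.prems by (simp add: reached_def)
  moreover have "\<forall>\<Theta>'\<in>reached i. finite (symbols \<Theta>')"
    using Suc.IH by (simp add: well_formed_def forest_def)
  ultimately show ?case
  proof (cases rule: next_states_cases)
    case (old \<Theta>' k l)
    then show ?thesis
      using Suc.IH[OF old(1)] well_formed_merge_old[of \<Theta>' k l] by (auto simp: merge_old_def)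
  next
    case (new \<Theta>' k)
    have "index \<Theta> = Suc (index \<Theta>')"
      using new by (simp add: merge_new_def)
    then show ?thesis
      using Suc.IH[OF new(1)] well_formed_merge_new[of \<Theta>' k] new by auto
  qed
qed

lemma reached_Suc: "reached (Suc i) = next_states u \<kappa> X (reached i)"
  by (simp add: reached_def)

section \<open>Finiteness of the state sets and termination\<close>

lemma finite_next_states:
  assumes "finite \<Phi>"
  shows "finite (next_states u \<kappa> X \<Phi>)"
proof -
  let ?I = "\<lambda>\<Theta>. {..card (symbols \<Theta>)}"
  have "next_states u \<kappa> X \<Phi> \<subseteq> (\<Union>\<Theta>\<in>\<Phi>. (\<lambda>(j, k). step_a u \<kappa> \<Theta> j k) ` (?I \<Theta> \<times> ?I \<Theta>)) \<union>
      (\<Union>\<Theta>\<in>\<Phi>. step_b u \<kappa> \<Theta> ` ?I \<Theta>)"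
    unfolding next_states_def Let_def by fastforce
  then show ?thesis
    by (rule finite_subset) (use assms in auto)
qed

lemma finite_reached: "finite (reached i)"
  by (induction i) (simp_all add: reached_Suc finite_next_states, simp add: reached_def)

lemma reached_eventually_empty: "reached (card (dom X) + max_new) = {}"
proof (rule ccontr)
  assume "reached (card (dom X) + max_new) \<noteq> {}"
  then obtain \<Theta> where "\<Theta> \<in> reached (card (dom X) + max_new)" by blast
  from well_formed_reached[OF this] have "card (symbols \<Theta>) = 0" "well_formed \<Theta>" by auto
  then show False
    by (simp add: well_formed_def forest_def)
qed

lemma reached_empty_mono: "i \<le> j \<Longrightarrow> reached i = {} \<Longrightarrow> reached j = {}"
proof (induction j rule: dec_induct)
  case (step j)
  then show ?case
    by (simp add: reached_Suc next_states_def)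
qed

text \<open>\<open>Suc i\<close> because output is collected only after a transition: for a single
  symbol in \<open>X\<close>, the initial state has one symbol but is not collected on that
  account.\<close>

definition final_states :: "'a ext_state set" where
  "final_states = {\<Theta>. \<exists>i. \<Theta> \<in> reached (Suc i) \<and> card (symbols \<Theta>) = 1}"

lemma finite_final_states: "finite final_states"
proof -
  have "final_states \<subseteq> (\<Union>i<card (dom X) + max_new. reached i)"
  proof
    fix \<Theta> assume "\<Theta> \<in> final_states"
    then obtain i where i: "\<Theta> \<in> reached (Suc i)"
      by (auto simp: final_states_def)
    with reached_empty_mono[OF _ reached_eventually_empty, of "Suc i"]
    have "Suc i < card (dom X) + max_new"
      by (metis empty_iff not_le)
    with i show "\<Theta> \<in> (\<Union>i<card (dom X) + max_new. reached i)"
      by blast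
  qed
  then show ?thesis
    by (rule finite_subset) (simp add: finite_reached)
qed

lemma enumeration_eq: "\<exists>i. enumeration u \<kappa> X = Some ({}, final_states, i)"
proof -
  let ?body = "loop_body u \<kappa> X" and ?init = "initial_loop_state u X"
  have state: "(?body ^^ i) ?init =
      (reached i, {\<Theta>. \<exists>j<i. \<Theta> \<in> reached (Suc j) \<and> card (symbols \<Theta>) = 1}, i)" for i
  proof (induction i)
    case 0
    show ?case by (simp add: initial_loop_state_def reached_def)
  next
    case (Suc i)
    then show ?case
      by (auto simp: loop_body_def reached_Suc Let_def less_Suc_eq)
  qed
  let ?b = "\<lambda>(\<Phi>, \<Psi>, i). \<Phi> \<noteq> {}"
  \<comment> \<open>The body has already run once when the loop starts, which shifts the count by
    one.\<close>
  have iter: "(?body ^^ i) (?body ?init) = (?body ^^ Suc i) ?init" for i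
    by (simp add: funpow_swap1)
  have "reached (Suc (card (dom X) + max_new)) = {}"
    by (rule reached_empty_mono[OF _ reached_eventually_empty]) simp
  then have ex: "\<exists>i. \<not> ?b ((?body ^^ i) (?body ?init))"
    unfolding iter state by auto
  define N where "N = (LEAST i. \<not> ?b ((?body ^^ i) (?body ?init)))"
  have "enumeration u \<kappa> X = Some ((?body ^^ N) (?body ?init))"
    unfolding enumeration_def while_option_def N_def using ex by (simp only: if_True)
  moreover have "\<not> ?b ((?body ^^ N) (?body ?init))"
    unfolding N_def by (rule LeastI_ex[OF ex])
  then have N: "reached (Suc N) = {}"
    unfolding iter state by simp
  \<comment> \<open>After the first empty set all later ones are empty, so no output is missed by
    stopping there.\<close>
  moreover have "j < Suc N" if "\<Theta> \<in> reached (Suc j)" for j \<Theta>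
    using reached_empty_mono[OF _ N, of "Suc j"] that by (metis Suc_le_mono empty_iff le_SucI not_less)
  then have "{\<Theta>. \<exists>j<Suc N. \<Theta> \<in> reached (Suc j) \<and> card (symbols \<Theta>) = 1} = final_states"
    unfolding final_states_def by blast
  ultimately show ?thesis
    unfolding iter state by auto
qed

end

declare domIff [iff del]

section \<open>Simulating Huffman's algorithm\<close>

text \<open>A source with \<open>n\<close> new symbols, named in order of increasing probability.
  From \<open>n\<close> on, \<open>u i\<close> does not belong to the source and gets the value 1,
  so that it never counts as too small. \<open>c\<close> stands for the cost of the code with which
  the run starts.\<close>

locale huffman_run = enumeration_input +
  fixes q :: "'a \<Rightarrow> real" and n :: nat and c :: real
  assumes q_X: "\<And>x. x \<in> dom X \<Longrightarrow> q x = pr X x"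
    and q_pos: "\<And>i. i < n \<Longrightarrow> 0 < q (u i)"
    and q_ge: "\<And>i. n \<le> i \<Longrightarrow> q (u i) = 1"
    and q_mono: "\<And>i j. i \<le> j \<Longrightarrow> q (u i) \<le> q (u j)"
    and q_sum: "sum q (dom X \<union> u ` {..<n}) = 1"
begin

abbreviation D :: "'a set" where
  "D \<equiv> dom X \<union> u ` {..<n}"

definition fewer_symbols_suffice :: bool where
  "fewer_symbols_suffice \<longleftrightarrow>
     (\<exists>r t. weighted_tree X r t \<and> card (leaves t - dom X) < n \<and>
        tree_redundancy r t \<le> c + (\<Sum>a\<in>D. q a * log 2 (q a)))"

text \<open>The inequalities bound \<open>u (index \<Theta>)\<close> only from below, so they survive raising
  its value to 1, as the consistency test demands.\<close>

definition invar :: "'a ext_state \<Rightarrow> bool" where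
  "invar \<Theta> \<longleftrightarrow> well_formed \<Theta> \<and> index \<Theta> \<le> n \<and>
     (\<forall>r. (\<forall>a\<in>dom X \<union> u ` {..<index \<Theta>}. r a = q a) \<and> q (u (index \<Theta>)) \<le> r (u (index \<Theta>)) \<longrightarrow>
        (\<forall>z\<in>ineqs \<Theta>. satisfies r z)) \<and>
     (\<forall>i\<in>{1..index \<Theta>}. Min (pr X ` dom X) \<le> q (u i)) \<and>
     (\<exists>T. distinct_leaves T \<and> leaves T = symbols \<Theta> \<union> Atom ` u ` {index \<Theta>..<n} \<and>
        cost q (flat T) \<le> c)"

lemma finite_D: "finite D"
  using finite_X by simp

lemma q_pos_D: "a \<in> D \<Longrightarrow> 0 < q a"
  using q_X X_pos q_pos by auto

lemma q_sum_split: "(\<Sum>x\<in>dom X. pr X x) + (\<Sum>i<n. q (u i)) = 1"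
proof -
  have "sum q D = sum q (dom X) + sum q (u ` {..<n})"
    using finite_X by (intro sum.union_disjoint) auto
  also have "sum q (u ` {..<n}) = (\<Sum>i<n. q (u i))"
    by (subst sum.reindex) (auto simp: inj_on_def)
  finally show ?thesis
    using q_sum q_X by simp
qed

lemma q_le_1: "q (u i) \<le> 1"
  using q_mono[of i "max i n"] q_ge[of "max i n"] by simp

lemma sum_prefix_le:
  assumes "s \<le> n"
  shows "(\<Sum>x\<in>dom X. pr X x) + (\<Sum>i<s. q (u i)) \<le> 1"
proof -
  have "(\<Sum>i<s. q (u i)) \<le> (\<Sum>i<n. q (u i))"
    using assms q_pos by (intro sum_mono2) (auto intro: less_imp_le)
  with q_sum_split show ?thesis by simp
qed

lemma symbol_leaves:
  assumes "invar \<Theta>" and "k \<in> symbols \<Theta>"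
  shows "distinct_leaves k" "leaves k \<subseteq> dom X \<union> u ` {..<index \<Theta>}" "leaves k \<subseteq> D"
proof -
  have *: "\<Union>(leaves ` symbols \<Theta>) = dom X \<union> u ` {..<index \<Theta>}" "index \<Theta> \<le> n" "forest (symbols \<Theta>)"
    using assms(1) by (simp_all add: invar_def well_formed_def)
  show "leaves k \<subseteq> dom X \<union> u ` {..<index \<Theta>}"
    using *(1) assms(2) by blast
  also have "\<dots> \<subseteq> D"
    using *(2) by auto
  finally show "leaves k \<subseteq> D" .
  show "distinct_leaves k"
    using * assms(2) by (simp add: forest_def)
qed

text \<open>The upper bound is compared with the value 1 of the absent new symbols; the lower bound
  comes from a leaf in \<open>X\<close>.\<close>

lemma symbol_prob_bounds:
  assumes "invar \<Theta>" and "k \<in> symbols \<Theta>"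
  shows "sym_prob q k \<le> 1" "Min (pr X ` dom X) \<le> sym_prob q k"
proof -
  note k = symbol_leaves[OF assms]
  have eq: "sym_prob q k = sum q (leaves k)"
    by (rule sym_prob_eq_sum[OF k(1)])
  have "sum q (leaves k) \<le> sum q D"
    using k(3) finite_D by (intro sum_mono2) (auto intro: less_imp_le[OF q_pos_D])
  then show "sym_prob q k \<le> 1"
    using eq q_sum by simp
  have "leaves k \<inter> dom X \<noteq> {}"
    using assms by (simp add: invar_def well_formed_def)
  then obtain x where x: "x \<in> leaves k" "x \<in> dom X"
    by blast
  have "Min (pr X ` dom X) \<le> q x"
    using x finite_X by (simp add: q_X)
  also have "q x \<le> sum q (leaves k)"
    using x k(3) by (intro member_le_sum) (auto intro: less_imp_le[OF q_pos_D])
  finally show "Min (pr X ` dom X) \<le> sym_prob q k"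
    using eq by simp
qed

lemma invar_consistent:
  assumes "invar \<Theta>"
  shows "consistent u X \<Theta>"
proof -
  let ?s = "index \<Theta>"
  \<comment> \<open>The sum constraint involves only \<open>u i\<close> with \<open>i < ?s\<close>,
    so it is not affected by raising \<open>u ?s\<close>.\<close>
  let ?r = "q(u ?s := 1)"
  have "\<forall>a\<in>dom X \<union> u ` {..<?s}. ?r a = q a"
    using u_notin_X by (auto simp: fun_upd_def)
  moreover have "q (u ?s) \<le> ?r (u ?s)"
    by (simp add: q_le_1)
  ultimately have "\<forall>z\<in>ineqs \<Theta>. satisfies ?r z"
    using assms unfolding invar_def by blast
  moreover have "\<forall>x\<in>dom X. ?r x = pr X x"
    using q_X u_notin_X by (auto simp: fun_upd_def)
  moreover have "(\<Sum>x\<in>dom X. pr X x) + (\<Sum>i<?s. ?r (u i)) \<le> 1"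
    using sum_prefix_le[of ?s] assms by (simp add: invar_def)
  ultimately show ?thesis
    unfolding consistent_def by (intro exI[of _ ?r]) simp
qed

lemma forest_symbols_Atoms:
  assumes "well_formed \<Theta>"
  shows "forest (symbols \<Theta> \<union> Atom ` u ` {index \<Theta>..<n})"
proof (rule forest_Un_Atoms)
  show "u ` {index \<Theta>..<n} \<inter> \<Union>(leaves ` symbols \<Theta>) = {}"
    using Atom_u_notin(1)[OF assms] by fastforce
qed (use assms in \<open>simp_all add: well_formed_def\<close>)

lemma Atoms_Diff: "Atom ` u ` {i..<n} - {Atom (u i)} = Atom ` u ` {Suc i..<n}"
proof -
  have "Atom ` u ` {i..<n} - {Atom (u i)} = Atom ` u ` ({i..<n} - {i})"
    by auto
  also have "{i..<n} - {i} = {Suc i..<n}"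
    by auto
  finally show ?thesis .
qed

text \<open>As the new symbols are sorted, comparison with \<open>u (index \<Theta>)\<close> settles
  the comparison with all that remain. So \<open>k\<close> and \<open>l\<close> are lightest among
  all leaves of the outer tree.\<close>

lemma invar_merge_old:
  assumes inv: "invar \<Theta>" and kl: "k \<in> symbols \<Theta>" "l \<in> symbols \<Theta>" "k \<noteq> l"
    and least: "\<And>m. m \<in> symbols \<Theta> - {k, l} \<Longrightarrow> sym_prob q k \<le> sym_prob q m \<and> sym_prob q l \<le> sym_prob q m"
    and least_u: "sym_prob q k \<le> q (u (index \<Theta>))" "sym_prob q l \<le> q (u (index \<Theta>))"
  shows "invar (merge_old u \<Theta> k l)"
proof -
  let ?s = "index \<Theta>" and ?K = "symbols \<Theta>"
  have wf: "well_formed \<Theta>" "forest ?K"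
    using inv by (simp_all add: invar_def well_formed_def)
  obtain T where T: "distinct_leaves T" "leaves T = ?K \<union> Atom ` u ` {?s..<n}" "cost q (flat T) \<le> c"
    using inv unfolding invar_def by blast
  have "\<exists>T'. distinct_leaves T' \<and> leaves T' = insert (Merge k l) (leaves T - {k, l}) \<and>
      cost q (flat T') \<le> cost q (flat T)"
  proof (rule greedy_merge)
    fix m assume "m \<in> leaves T - {k, l}"
    then consider "m \<in> ?K - {k, l}" | i where "?s \<le> i" "m = Atom (u i)"
      unfolding T(2) by fastforce
    then show "sym_prob q k \<le> sym_prob q m \<and> sym_prob q l \<le> sym_prob q m"
    proof cases
      case 2
      then show ?thesis
        using least_u q_mono[of ?s i] by auto
    qed (use least in auto)
  qed (use T forest_symbols_Atoms[OF wf(1)] kl in auto)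
  then obtain T' where T': "distinct_leaves T'" "leaves T' = insert (Merge k l) (leaves T - {k, l})"
      "cost q (flat T') \<le> cost q (flat T)"
    by blast
  have "k \<notin> Atom ` u ` {?s..<n}" "l \<notin> Atom ` u ` {?s..<n}"
    using Atom_u_notin(2)[OF wf(1)] kl by auto
  then have leaves_T': "leaves T' = insert (Merge k l) (?K - {k, l}) \<union> Atom ` u ` {?s..<n}"
    unfolding T'(2) T(2) by blast
  have "satisfies r z"
    if r: "\<forall>a\<in>dom X \<union> u ` {..<?s}. r a = q a" "q (u ?s) \<le> r (u ?s)"
      and z: "z \<in> ineqs (merge_old u \<Theta> k l)" for r z
  proof -
    have sym: "sym_prob r m = sym_prob q m" if "m \<in> ?K" for m
      using symbol_leaves(2)[OF inv that] r(1) by (intro sym_prob_cong) blast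
    have "satisfies r y" if "y \<in> ineqs \<Theta>" for y
      using inv r that unfolding invar_def by blast
    moreover have "sym_prob q k \<le> sym_prob q m" if "m \<in> ?K - {l}" for m
      using least[of m] that by (cases "m = k") auto
    moreover have "sym_prob q l \<le> sym_prob q m" if "m \<in> ?K - {k}" for m
      using least[of m] that by (cases "m = l") auto
    moreover consider "z \<in> ineqs \<Theta>" | m where "z = Leq k m" "m \<in> ?K - {l}"
      | m where "z = Leq l m" "m \<in> ?K - {k}"
      | "z = Leq k (Atom (u ?s))" | "z = Leq l (Atom (u ?s))"
      using z by (auto simp: merge_old_def)
    then show ?thesis
      by cases (use calculation kl least_u r(2) in \<open>auto simp: sym\<close>)
  qed
  moreover have "index \<Theta> \<le> n" "\<forall>i\<in>{1..?s}. Min (pr X ` dom X) \<le> q (u i)"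
    using inv by (simp_all add: invar_def)
  ultimately show ?thesis
    using well_formed_merge_old(1)[OF wf(1) kl] T' T leaves_T' unfolding invar_def
    by (intro conjI) (auto simp: merge_old_def intro!: exI[of _ T'])
qed

lemma invar_merge_new:
  assumes inv: "invar \<Theta>" and k: "k \<in> symbols \<Theta>" and s: "index \<Theta> < n"
    and least: "\<And>m. m \<in> symbols \<Theta> \<Longrightarrow> sym_prob q k \<le> sym_prob q m"
    and least_u: "\<And>m. m \<in> symbols \<Theta> - {k} \<Longrightarrow> q (u (index \<Theta>)) \<le> sym_prob q m"
    and k_u: "sym_prob q k \<le> q (u (Suc (index \<Theta>)))"
  shows "invar (merge_new u \<Theta> k)"
proof -
  let ?s = "index \<Theta>" and ?K = "symbols \<Theta>" and ?a = "Atom (u (index \<Theta>))"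
  have wf: "well_formed \<Theta>" "forest ?K"
    using inv by (simp_all add: invar_def well_formed_def)
  have a: "?a \<notin> ?K"
    by (rule Atom_u_notin(2)[OF wf(1)]) simp
  obtain T where T: "distinct_leaves T" "leaves T = ?K \<union> Atom ` u ` {?s..<n}" "cost q (flat T) \<le> c"
    using inv unfolding invar_def by blast
  have "\<exists>T'. distinct_leaves T' \<and> leaves T' = insert (Merge k ?a) (leaves T - {k, ?a}) \<and>
      cost q (flat T') \<le> cost q (flat T)"
  proof (rule greedy_merge)
    fix m assume "m \<in> leaves T - {k, ?a}"
    then have "m \<in> (?K - {k}) \<union> Atom ` u ` {Suc ?s..<n}"
      unfolding T(2) Atoms_Diff[symmetric] by blast
    then consider "m \<in> ?K - {k}" | i where "Suc ?s \<le> i" "m = Atom (u i)"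
      by auto
    then show "sym_prob q k \<le> sym_prob q m \<and> sym_prob q ?a \<le> sym_prob q m"
    proof cases
      case 2
      then show ?thesis
        using k_u q_mono[of "Suc ?s" i] q_mono[of ?s i] by auto
    qed (use least least_u in auto)
  qed (use T forest_symbols_Atoms[OF wf(1)] k s a in auto)
  then obtain T' where T': "distinct_leaves T'" "leaves T' = insert (Merge k ?a) (leaves T - {k, ?a})"
      "cost q (flat T') \<le> cost q (flat T)"
    by blast
  have "k \<notin> Atom ` u ` {?s..<n}"
    using Atom_u_notin(2)[OF wf(1)] k by auto
  then have leaves_T': "leaves T' = insert (Merge k ?a) (?K - {k}) \<union> Atom ` u ` {Suc ?s..<n}"
    unfolding T'(2) T(2) Atoms_Diff[symmetric] using a by blast
  have "satisfies r z"
    if r: "\<forall>a\<in>dom X \<union> u ` {..<Suc ?s}. r a = q a" "q (u (Suc ?s)) \<le> r (u (Suc ?s))"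
      and z: "z \<in> ineqs (merge_new u \<Theta> k)" for r z
  proof -
    have sym: "sym_prob r m = sym_prob q m" if "m \<in> ?K" for m
      using symbol_leaves(2)[OF inv that] r(1)
      by (intro sym_prob_cong) (auto simp: lessThan_Suc)
    have u: "r (u ?s) = q (u ?s)"
      using r(1) by simp
    have "satisfies r y" if "y \<in> ineqs \<Theta>" for y
    proof -
      have "\<forall>a\<in>dom X \<union> u ` {..<?s}. r a = q a" "q (u ?s) \<le> r (u ?s)"
        using r(1) by auto
      with inv that show ?thesis
        unfolding invar_def by blast
    qed
    moreover have "q (u ?s) \<le> q (u (Suc ?s))"
      by (rule q_mono) simp
    moreover consider "z \<in> ineqs \<Theta>" | m where "z = Leq k m" "m \<in> ?K"
      | m where "z = Leq ?a m" "m \<in> ?K - {k}"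
      | "z = Leq k (Atom (u (Suc ?s)))" | "z = Leq ?a (Atom (u (Suc ?s)))"
      using z by (auto simp: merge_new_def)
    then show ?thesis
      by cases (use calculation k least least_u k_u r(2) u in \<open>auto simp: sym\<close>)
  qed
  \<comment> \<open>The only new bound is for \<open>u (Suc ?s)\<close>: it is at least as probable
    as \<open>k\<close>, which contains a symbol of \<open>X\<close>.\<close>
  moreover have "\<forall>i\<in>{1..Suc ?s}. Min (pr X ` dom X) \<le> q (u i)"
    using inv order_trans[OF symbol_prob_bounds(2)[OF inv k] k_u]
    by (auto simp: invar_def le_Suc_eq)
  ultimately show ?thesis
    using well_formed_merge_new(1)[OF wf(1) k] T' T leaves_T' s unfolding invar_def
    by (intro conjI) (auto simp: merge_new_def intro!: exI[of _ T'])
qed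

text \<open>With \<open>s = index \<Theta>\<close>, the symbols \<open>u 1, ..., u s\<close> each
  weigh at least the least probability of \<open>X\<close>, while \<open>u 0\<close> is merely
  positive. All of them share the mass that \<open>X\<close> leaves. Positivity of
  \<open>u 0\<close> makes the estimate strict, hence \<open>s\<close> lies strictly below the
  ceiling in \<open>size_bound X\<close>.\<close>

lemma index_less_max_new:
  assumes inv: "invar \<Theta>" and s: "index \<Theta> < n"
  shows "index \<Theta> < max_new"
proof -
  let ?s = "index \<Theta>" and ?p = "Min (pr X ` dom X)"
  have p: "0 < ?p"
    using finite_X X_nonempty X_pos by (subst Min_gr_iff) auto
  have "real ?s * ?p = (\<Sum>i<?s. ?p)"
    by simp
  also have "\<dots> \<le> (\<Sum>i<?s. q (u (Suc i)))"
    using inv by (intro sum_mono) (auto simp: invar_def)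
  also have "\<dots> < q (u 0) + (\<Sum>i<?s. q (u (Suc i)))"
    using q_pos s by simp
  also have "\<dots> = (\<Sum>i<Suc ?s. q (u i))"
    by (simp add: sum.lessThan_Suc_shift del: sum.lessThan_Suc)
  also have "\<dots> \<le> 1 - (\<Sum>x\<in>dom X. pr X x)"
    using sum_prefix_le[of "Suc ?s"] s by simp
  finally have "real_of_int (int ?s) < (1 - (\<Sum>x\<in>dom X. pr X x)) / ?p"
    using p by (simp add: pos_less_divide_eq)
  then have "int ?s < \<lceil>(1 - (\<Sum>x\<in>dom X. pr X x)) / ?p\<rceil>"
    by (simp only: less_ceiling_iff)
  then show ?thesis
    by (simp add: max_new_def size_bound_def)
qed

text \<open>Replacing sibling leaves of probabilities \<open>x\<close> and \<open>y\<close> by a single leaf lowers the redundancy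
  by \<open>(x + y) (1 - h (x / (x + y)))\<close>, where \<open>h \<le> 1\<close> is the binary entropy function.\<close>

lemma fewer_symbols:
  assumes inv: "invar \<Theta>" and s: "Suc (index \<Theta>) < n"
    and least: "\<And>m. m \<in> symbols \<Theta> \<Longrightarrow> q (u (Suc (index \<Theta>))) \<le> sym_prob q m"
  shows fewer_symbols_suffice
proof -
  let ?s = "index \<Theta>" and ?K = "symbols \<Theta>"
  \<comment> \<open>\<open>u n\<close> is the first name outside the source and serves as the fresh
    leaf.\<close>
  let ?a = "u (index \<Theta>)" and ?b = "u (Suc (index \<Theta>))" and ?v = "u n"
  let ?r = "q(?v := q ?a + q ?b)"
  have wf: "well_formed \<Theta>" "\<Union>(leaves ` ?K) = dom X \<union> u ` {..<?s}"
    using inv by (simp_all add: invar_def well_formed_def)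
  obtain T where T: "distinct_leaves T" "leaves T = ?K \<union> Atom ` u ` {?s..<n}" "cost q (flat T) \<le> c"
    using inv unfolding invar_def by blast
  have union_T: "\<Union>(leaves ` leaves T) = D"
  proof -
    have "\<Union>(leaves ` leaves T) = dom X \<union> (u ` {..<?s} \<union> u ` {?s..<n})"
      unfolding T(2) using wf(2) by auto
    also have "u ` {..<?s} \<union> u ` {?s..<n} = u ` {..<n}"
      using s by (auto simp: image_Un[symmetric])
    finally show ?thesis .
  qed
  have le: "q ?a \<le> q ?b"
    by (rule q_mono) simp
  have forest: "forest (leaves T)"
    using forest_symbols_Atoms[OF wf(1)] T(2) by simp
  have v: "?v \<notin> D"
    by auto
  have "\<exists>T'. distinct_leaves T' \<and> leaves T' = insert (Atom ?v) (leaves T - {Atom ?a, Atom ?b}) \<and>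
      cost ?r (flat T') + q ?a + q ?b \<le> cost q (flat T)"
  proof (rule greedy_replace[OF T(1) forest])
    fix m assume "m \<in> leaves T - {Atom ?a, Atom ?b}"
    then have "m \<in> ?K \<union> Atom ` u ` {Suc ?s..<n}"
      unfolding T(2) Atoms_Diff[symmetric] by blast
    then consider "m \<in> ?K" | i where "Suc ?s \<le> i" "m = Atom (u i)"
      by auto
    then show "q ?a \<le> sym_prob q m \<and> q ?b \<le> sym_prob q m"
    proof cases
      case 1
      then show ?thesis
        using least[of m] le by auto
    next
      case 2
      then show ?thesis
        using q_mono[of "Suc ?s" i] le by auto
    qed
  qed (use T s v union_T in auto)
  then obtain T' where T': "distinct_leaves T'"
      "leaves T' = insert (Atom ?v) (leaves T - {Atom ?a, Atom ?b})"
      "cost ?r (flat T') + q ?a + q ?b \<le> cost q (flat T)"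
    by blast
  have ab: "?a \<in> D" "?b \<in> D" "?a \<noteq> ?b"
    using s by auto
  have disjoint: "e \<notin> leaves m" if "m \<in> leaves T" "m \<noteq> Atom e" "Atom e \<in> leaves T" for e m
  proof -
    have "leaves m \<inter> leaves (Atom e) = {}"
      using forest that unfolding forest_def by blast
    then show ?thesis by simp
  qed
  have Atoms: "Atom ?a \<in> leaves T" "Atom ?b \<in> leaves T"
    using s T(2) by auto
  have "\<Union>(leaves ` (leaves T - {Atom ?a, Atom ?b})) = D - {?a, ?b}"
    unfolding union_T[symmetric] using disjoint Atoms by fastforce
  then have leaves_T': "leaves (flat T') = insert ?v (D - {?a, ?b})"
    unfolding leaves_flat T'(2) by simp
  have "forest (leaves T - {Atom ?a, Atom ?b})"
    using forest by (rule forest_subset) auto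
  then have "forest (leaves T')"
    unfolding T'(2) using v unfolding union_T[symmetric] by (intro forest_insert_Atom) blast+
  then have dist: "distinct_leaves (flat T')"
    using T'(1) by (intro distinct_leaves_flat)
  have sums: "sum f D = sum f (D - {?a, ?b}) + f ?a + f ?b"
    "sum f (insert ?v (D - {?a, ?b})) = sum f (D - {?a, ?b}) + f ?v" for f :: "'a \<Rightarrow> real"
    using finite_D ab v by (auto simp: sum.subset_diff[of "{?a, ?b}" D])
  have r: "?r e = q e" if "e \<in> D" for e
    using that v by auto
  have r_sum: "(\<Sum>e\<in>D - {?a, ?b}. f (?r e)) = (\<Sum>e\<in>D - {?a, ?b}. f (q e))" for f :: "real \<Rightarrow> real"
    using r by (intro sum.cong) auto
  have "sum ?r (leaves (flat T')) = 1"
    using q_sum sums(1)[of q] r_sum[of "\<lambda>p. p"] unfolding leaves_T' sums(2) by simp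
  moreover obtain x where x: "x \<in> dom X"
    using X_nonempty by blast
  have "{x, ?v} \<subseteq> leaves (flat T')" "x \<noteq> ?v"
    using x u_notin_X unfolding leaves_T' by auto
  then have "2 \<le> card (leaves (flat T'))"
    using card_mono[of "leaves (flat T')" "{x, ?v}"] by simp
  moreover have "dom X \<subseteq> leaves (flat T')"
    using u_notin_X unfolding leaves_T' by auto
  moreover have "0 < ?r e" if "e \<in> leaves (flat T')" for e
  proof (cases "e = ?v")
    case True
    then show ?thesis
      using q_pos[of ?s] q_pos[of "Suc ?s"] s by simp
  next
    case False
    with that have "e \<in> D"
      unfolding leaves_T' by blast
    with False q_pos_D show ?thesis
      by simp
  qed
  ultimately have wt: "weighted_tree X ?r (flat T')"
    using dist r q_X unfolding weighted_tree_def by auto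
  \<comment> \<open>One new symbol replaces two, which leaves \<open>n - 1\<close> of them.\<close>
  have "leaves (flat T') - dom X = insert ?v (u ` ({..<n} - {?s, Suc ?s}))"
    unfolding leaves_T' by (auto simp: u_notin_X)
  moreover have "card (u ` ({..<n} - {?s, Suc ?s})) = n - 2"
    using s by (subst card_image) (auto simp: inj_on_def card_Diff_subset)
  moreover have "?v \<notin> u ` ({..<n} - {?s, Suc ?s})"
    by auto
  ultimately have "card (leaves (flat T') - dom X) < n"
    using s by simp
  moreover have "tree_redundancy ?r (flat T') \<le> c + (\<Sum>a\<in>D. q a * log 2 (q a))"
  proof -
    have "(q ?a + q ?b) * log 2 (q ?a + q ?b)
        \<le> q ?a * log 2 (q ?a) + q ?b * log 2 (q ?b) + (q ?a + q ?b)"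
      using s by (intro mult_log_add_le q_pos) auto
    then show ?thesis
      using T'(3) T(3) sums(1)[of "\<lambda>a. q a * log 2 (q a)"] r_sum[of "\<lambda>p. p * log 2 p"]
      unfolding tree_redundancy_def leaves_T' sums(2) by simp
  qed
  ultimately show ?thesis
    using wt unfolding fewer_symbols_suffice_def by blast
qed

text \<open>The case distinction asks which two leaves of the outer tree are lightest: two present
  symbols, a present symbol and \<open>u s\<close>, or \<open>u s\<close> and
  \<open>u (s + 1)\<close>, where \<open>s = index \<Theta>\<close>. Ties are decided in favour of
  present symbols.\<close>

lemma invar_step:
  assumes inv: "invar \<Theta>" and reach: "\<Theta> \<in> reached i"
    and more: "2 \<le> card (symbols \<Theta>) + (n - index \<Theta>)"
  shows "fewer_symbols_suffice \<or>
    (\<exists>\<Theta>'\<in>reached (Suc i). invar \<Theta>' \<and>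
       card (symbols \<Theta>') + (n - index \<Theta>') + 1 = card (symbols \<Theta>) + (n - index \<Theta>))"
proof -
  let ?s = "index \<Theta>" and ?K = "symbols \<Theta>" and ?w = "sym_prob q"
  have wf: "well_formed \<Theta>" "finite ?K" "?K \<noteq> {}" and sn: "?s \<le> n"
    using inv by (simp_all add: invar_def well_formed_def forest_def)
  obtain k where k: "k \<in> ?K" and least_k: "\<And>m. m \<in> ?K \<Longrightarrow> ?w k \<le> ?w m"
    using ex_min_if_finite[of "?w ` ?K"] wf(2,3) by (metis (no_types, lifting) arg_min_if_finite(1) arg_min_least)
  show ?thesis
  proof (cases "\<exists>l\<in>?K - {k}. ?w l \<le> q (u ?s)")
    case True
    then have ne: "?K - {k} \<noteq> {}"
      by blast
    obtain l where l: "l \<in> ?K - {k}" and least_l: "\<And>m. m \<in> ?K - {k} \<Longrightarrow> ?w l \<le> ?w m"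
      using wf(2) ne by (metis (no_types, lifting) arg_min_if_finite(1) arg_min_least finite_Diff)
    have l_u: "?w l \<le> q (u ?s)"
      using True least_l by (meson order_trans)
    have "?w k \<le> q (u ?s)"
      using least_k[of l] l l_u by auto
    with l l_u k least_k least_l
    have invs: "invar (merge_old u \<Theta> k l)" "invar (merge_old u \<Theta> l k)"
      by (auto intro!: invar_merge_old[OF inv])
    then have "merge_old u \<Theta> k l \<in> reached (Suc i) \<or> merge_old u \<Theta> l k \<in> reached (Suc i)"
      unfolding reached_Suc using reach wf(2) k l invar_consistent
      by (intro merge_old_next_states) auto
    moreover have "card (symbols (merge_old u \<Theta> k l)) + 1 = card ?K"
      "card (symbols (merge_old u \<Theta> l k)) + 1 = card ?K"
      using well_formed_merge_old(2)[OF wf(1)] k l by blast+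
    moreover have "index (merge_old u \<Theta> k l) = ?s" "index (merge_old u \<Theta> l k) = ?s"
      by (simp_all add: merge_old_def)
    ultimately show ?thesis
      using invs by (metis add.commute add.left_commute)
  next
    case False
    \<comment> \<open>Were all new symbols used up, a second present symbol would exist and exceed
      the value 1 of \<open>u ?s\<close>.\<close>
    have s: "?s < n"
    proof (rule ccontr)
      assume "\<not> ?s < n"
      then have "card (?K - {k}) \<noteq> 0" "q (u ?s) = 1"
        using more sn k wf(2) q_ge by auto
      then have "?K - {k} \<noteq> {}"
        by (metis card.empty)
      then obtain l where "l \<in> ?K - {k}"
        by blast
      with False symbol_prob_bounds(1)[OF inv, of l] \<open>q (u ?s) = 1\<close> show False
        by auto
    qed
    show ?thesis
    proof (cases "?w k \<le> q (u (Suc ?s))")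
      case True
      then have inv': "invar (merge_new u \<Theta> k)"
        using False least_k by (intro invar_merge_new[OF inv k s]) force+
      then have "merge_new u \<Theta> k \<in> reached (Suc i)"
        unfolding reached_Suc using reach wf(2) k invar_consistent index_less_max_new[OF inv s]
        by (intro merge_new_next_states) auto
      moreover have "index (merge_new u \<Theta> k) = Suc ?s"
        by (simp add: merge_new_def)
      ultimately show ?thesis
        using inv' well_formed_merge_new(2)[OF wf(1) k] s
        by (intro disjI2 bexI[of _ "merge_new u \<Theta> k"]) auto
    next
      case False
      then have "Suc ?s < n"
        using symbol_prob_bounds(1)[OF inv k] q_ge[of "Suc ?s"] by (cases "Suc ?s < n") auto
      moreover have "q (u (Suc ?s)) \<le> ?w m" if "m \<in> ?K" for m
        using False least_k[OF that] by linarith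
      ultimately show ?thesis
        using fewer_symbols[OF inv] by blast
    qed
  qed
qed

text \<open>\<open>m\<close> is the number of merges still to be made; each step performs one,
  unless the restart with fewer symbols takes over.\<close>

lemma invar_final:
  assumes "invar \<Theta>" and "\<Theta> \<in> reached i" and "card (symbols \<Theta>) + (n - index \<Theta>) = Suc m"
  shows "fewer_symbols_suffice \<or>
    (\<exists>\<Theta>'\<in>reached (i + m). \<exists>t. invar \<Theta>' \<and> symbols \<Theta>' = {t} \<and> index \<Theta>' = n)"
  using assms
proof (induction m arbitrary: \<Theta> i)
  case 0
  have "finite (symbols \<Theta>)" "symbols \<Theta> \<noteq> {}" "index \<Theta> \<le> n"
    using 0 by (auto simp: invar_def well_formed_def forest_def)
  moreover from this have "card (symbols \<Theta>) \<noteq> 0"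
    by simp
  ultimately have "card (symbols \<Theta>) = 1" "index \<Theta> = n"
    using 0(3) by linarith+
  with 0 show ?case
    by (metis add.right_neutral card_1_singletonE)
next
  case (Suc m)
  from invar_step[OF Suc.prems(1,2)] Suc.prems(3) consider fewer_symbols_suffice
    | \<Theta>' where "\<Theta>' \<in> reached (Suc i)" "invar \<Theta>'" "card (symbols \<Theta>') + (n - index \<Theta>') = Suc m"
    by fastforce
  then show ?case
  proof cases
    case 2
    from Suc.IH[OF this(2,1,3)] show ?thesis
      by simp
  qed blast
qed

lemma fewer_symbols_or_final:
  assumes t: "weighted_tree X q t" and leaves_t: "leaves t = D" and c: "c = cost q t"
  shows "fewer_symbols_suffice \<or>
    (\<exists>\<Theta>\<in>final_states. \<exists>t'. symbols \<Theta> = {t'} \<and> weighted_tree X q t' \<and>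
       tree_redundancy q t' \<le> tree_redundancy q t)"
proof -
  let ?\<Theta> = "State (Atom ` dom X) 0 {Nonneg (Atom (u 0))}"
  have reach: "?\<Theta> \<in> reached 0"
    by (simp add: reached_def)
  have "0 \<le> q (u 0)"
    using q_pos[of 0] q_ge[of 0] by (cases "n = 0") auto
  moreover have "distinct_leaves (map_sym Atom t)"
    using t by (intro distinct_leaves_map_sym) (auto simp: weighted_tree_def inj_on_def)
  moreover have "leaves (map_sym Atom t) = Atom ` dom X \<union> Atom ` u ` {0..<n}"
    using leaves_t by (simp add: image_Un atLeast0LessThan)
  ultimately have "\<exists>T. distinct_leaves T \<and> leaves T = symbols ?\<Theta> \<union> Atom ` u ` {index ?\<Theta>..<n} \<and>
        cost q (flat T) \<le> c"
    using c by (intro exI[of _ "map_sym Atom t"]) (simp add: flat_map_Atom)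
  then have inv: "invar ?\<Theta>"
    using well_formed_reached[OF reach] \<open>0 \<le> q (u 0)\<close> unfolding invar_def
    by (intro conjI) auto
  have "card (Atom ` dom X) = card (dom X)"
    by (intro card_image) (simp add: inj_on_def)
  moreover have "card (leaves t) = card (dom X) + n"
    unfolding leaves_t using finite_X
    by (subst card_Un_disjoint) (auto simp: card_image inj_on_def)
  moreover have "2 \<le> card (leaves t)"
    using t by (simp add: weighted_tree_def)
  \<comment> \<open>A source has at least two symbols, so at least one merge takes place, as
    membership in \<open>final_states\<close> requires.\<close>
  ultimately obtain m where m: "card (symbols ?\<Theta>) + (n - index ?\<Theta>) = Suc (Suc m)"
    by (metis One_nat_def Suc_1 Suc_le_D add_2_eq_Suc diff_zero ext_state.sel(1,2) le_Suc_ex)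
  from invar_final[OF inv reach m] show ?thesis
  proof
    assume "\<exists>\<Theta>'\<in>reached (0 + Suc m). \<exists>t'. invar \<Theta>' \<and> symbols \<Theta>' = {t'} \<and> index \<Theta>' = n"
    then obtain \<Theta>' t' where \<Theta>': "\<Theta>' \<in> reached (Suc m)" "invar \<Theta>'" "symbols \<Theta>' = {t'}" "index \<Theta>' = n"
      by auto
    have "\<Theta>' \<in> final_states"
      unfolding final_states_def using \<Theta>' by auto
    have t': "distinct_leaves t'" "leaves t' = D"
      using \<Theta>' by (auto simp: invar_def well_formed_def forest_def)
    obtain T where T: "distinct_leaves T" "leaves T = symbols \<Theta>' \<union> Atom ` u ` {index \<Theta>'..<n}"
        "cost q (flat T) \<le> c"
      using \<Theta>'(2) unfolding invar_def by blast
    \<comment> \<open>The outer tree has shrunk to one leaf, so the cost bound carried by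
      \<open>invar\<close> now speaks of the output code.\<close>
    have "leaves T = {t'}"
      using T(2) \<Theta>'(3,4) by simp
    moreover from this obtain e where "T = Atom e"
      using card_leaves_eq_1[OF _ T(1)] by force
    ultimately have "T = Atom t'"
      by simp
    then have "cost q t' \<le> cost q t"
      using T c by simp
    then have "weighted_tree X q t' \<and> tree_redundancy q t' \<le> tree_redundancy q t"
      using t t' leaves_t by (auto simp: weighted_tree_def tree_redundancy_def)
    with \<open>\<Theta>' \<in> final_states\<close> \<Theta>'(3) show ?thesis
      by blast
  qed blast
qed

end

section \<open>Renaming and sorting the new symbols of an arbitrary source\<close>

lemma ex_sorted_enumeration:
  fixes r :: "'a \<Rightarrow> real"
  assumes "finite U"
  shows "\<exists>h. bij_betw h {..<card U} U \<and> (\<forall>i j. i \<le> j \<and> j < card U \<longrightarrow> r (h i) \<le> r (h j))"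
proof -
  obtain xs where xs: "set xs = U" "distinct xs"
    using finite_distinct_list[OF assms] by blast
  let ?ys = "sort_key r xs"
  have ys: "set ?ys = U" "distinct ?ys" "length ?ys = card U"
    using xs distinct_card[of xs] by auto
  have "bij_betw ((!) ?ys) {..<card U} U"
    using bij_betw_nth[OF ys(2)] ys by simp
  moreover have "r (?ys ! i) \<le> r (?ys ! j)" if "i \<le> j" "j < card U" for i j
    using sorted_nth_mono[of "map r ?ys" i j] that ys(3) by simp
  ultimately show ?thesis
    by (intro exI[of _ "(!) ?ys"]) simp
qed

context enumeration_input
begin

text \<open>Induction on the number of new symbols: a run either ends in an output state or yields a
  tree, no worse, with fewer new symbols.\<close>

lemma final_state_le:
  assumes "weighted_tree X r t"
  shows "\<exists>\<Theta>\<in>final_states. \<exists>t' r'. symbols \<Theta> = {t'} \<and> weighted_tree X r' t' \<and>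
           tree_redundancy r' t' \<le> tree_redundancy r t"
  using assms
proof (induction "card (leaves t - dom X)" arbitrary: r t rule: less_induct)
  case less
  let ?U = "leaves t - dom X"
  define n where "n = card ?U"
  obtain h where h: "bij_betw h {..<n} ?U" "\<And>i j. i \<le> j \<Longrightarrow> j < n \<Longrightarrow> r (h i) \<le> r (h j)"
    using ex_sorted_enumeration[of ?U r] unfolding n_def by auto
  define g where "g = inv_into {..<n} h"
  have g: "bij_betw g ?U {..<n}" "\<And>a. a \<in> ?U \<Longrightarrow> h (g a) = a" "\<And>i. i < n \<Longrightarrow> g (h i) = i"
    using h(1) unfolding g_def
    by (auto simp: bij_betw_inv_into bij_betw_inv_into_right bij_betw_inv_into_left)
  \<comment> \<open>The new symbols are renamed in order of increasing probability, with indices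
    counted from 0.\<close>
  define f where "f a = (if a \<in> dom X then a else u (g a))" for a
  \<comment> \<open>\<open>inv_into UNIV u\<close> recovers the index of a new name; the default 1
    is the value that \<open>huffman_run\<close> prescribes from \<open>n\<close> on.\<close>
  define q where "q a = (if a \<in> dom X then r a
    else if a \<in> u ` {..<n} then r (h (inv_into UNIV u a)) else 1)" for a
  have X_sub: "dom X \<subseteq> leaves t" and r: "\<And>x. x \<in> dom X \<Longrightarrow> r x = pr X x"
    "\<And>a. a \<in> leaves t \<Longrightarrow> 0 < r a" "sum r (leaves t) = 1"
    using less.prems by (auto simp: weighted_tree_def)
  have q_u: "q (u i) = (if i < n then r (h i) else 1)" for i
    unfolding q_def using inj_u by (auto simp: inv_f_f)
  have h_U: "h i \<in> ?U" if "i < n" for i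
    using h(1) that by (auto simp: bij_betw_def)
  have inj_f: "inj_on f (leaves t)"
  proof (rule inj_onI)
    fix a b assume ab: "a \<in> leaves t" "b \<in> leaves t" "f a = f b"
    show "a = b"
    proof (cases "a \<in> dom X \<or> b \<in> dom X")
      case True
      with ab show ?thesis
        by (auto simp: f_def split: if_splits)
    next
      case False
      with ab have "g a = g b"
        by (simp add: f_def)
      with False ab g(2) show ?thesis
        by (metis DiffI)
    qed
  qed
  have q_f: "q (f a) = r a" if "a \<in> leaves t" for a
  proof (cases "a \<in> dom X")
    case False
    with that g have "g a < n" "h (g a) = a"
      by (auto simp: bij_betw_def)
    with False show ?thesis
      by (simp add: f_def q_u)
  qed (simp add: f_def q_def)
  have "f ` leaves t = f ` dom X \<union> f ` ?U"
    using X_sub by auto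
  also have "f ` dom X = dom X"
    by (simp add: f_def)
  also have "f ` ?U = u ` g ` ?U"
    by (auto simp: f_def)
  also have "g ` ?U = {..<n}"
    using g(1) by (simp add: bij_betw_def)
  finally have leaves: "leaves (map_sym f t) = dom X \<union> u ` {..<n}"
    by simp
  have fX: "f x = x" if "x \<in> dom X" for x
    using that by (simp add: f_def)
  note t' = weighted_tree_map_sym[OF less.prems inj_f fX q_f]
  have r_le_1: "r a \<le> 1" if "a \<in> leaves t" for a
    using member_le_sum[OF that, of r] r(2,3) by (force intro: less_imp_le)
  interpret huffman_run X u \<kappa> q n "cost q (map_sym f t)"
  proof unfold_locales
    show "q x = pr X x" if "x \<in> dom X" for x
      using that r(1) by (simp add: q_def)
    show "0 < q (u i)" if "i < n" for i
      using that h_U r(2) by (simp add: q_u)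
    show "q (u i) = 1" if "n \<le> i" for i
      using that by (simp add: q_u)
    show "q (u i) \<le> q (u j)" if "i \<le> j" for i j
      using that h(2)[of i j] r_le_1 h_U by (auto simp: q_u)
    show "sum q (dom X \<union> u ` {..<n}) = 1"
      using t'(1) leaves by (simp add: weighted_tree_def)
  qed
  from fewer_symbols_or_final[OF t'(1) leaves refl] show ?case
  proof
    assume fewer_symbols_suffice
    then obtain r1 t1 where 1: "weighted_tree X r1 t1" "card (leaves t1 - dom X) < n"
      "tree_redundancy r1 t1 \<le> cost q (map_sym f t) + (\<Sum>a\<in>dom X \<union> u ` {..<n}. q a * log 2 (q a))"
      unfolding fewer_symbols_suffice_def by blast
    have "tree_redundancy q (map_sym f t) =
        cost q (map_sym f t) + (\<Sum>a\<in>dom X \<union> u ` {..<n}. q a * log 2 (q a))"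
      by (simp only: tree_redundancy_def leaves)
    with 1(3) t'(2) have "tree_redundancy r1 t1 \<le> tree_redundancy r t"
      by simp
    with less.hyps[OF 1(2)[unfolded n_def] 1(1)] show ?thesis
      by (metis order_trans)
  next
    assume "\<exists>\<Theta>\<in>final_states. \<exists>t'. symbols \<Theta> = {t'} \<and> weighted_tree X q t' \<and>
       tree_redundancy q t' \<le> tree_redundancy q (map_sym f t)"
    with t'(2) show ?thesis
      by metis
  qed
qed

end

theorem mainTheorem4:
  fixes X A :: "'a prob_map"
    and u :: "nat \<Rightarrow> 'a"
    and \<kappa> :: "'a sym set \<Rightarrow> nat \<Rightarrow> 'a sym"
  assumes "is_source A" and "X \<sqsubseteq> A" and "1 \<le> card (dom X)"
    and "inj u" and "range u \<inter> dom X = {}"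
    and "is_numbering \<kappa>"
  shows "\<exists>\<Phi> \<Psi> i. enumeration u \<kappa> X = Some (\<Phi>, \<Psi>, i) \<and> finite \<Psi> \<and>
           is_minimum (general_bound X) (huffman_redundancies X) \<and>
           is_minimum (ereal (general_bound X)) (state_bound X ` \<Psi>)"
proof -
  have X: "finite (dom X)" "dom X \<noteq> {}" "dom X \<subseteq> dom A"
    using assms(1-3) by (auto simp: is_source_def sub_source_def intro: card_ge_0_finite
        dest: map_le_implies_dom_le)
  have "0 < pr X x" if "x \<in> dom X" for x
  proof -
    have "A x = X x"
      using assms(2) that by (auto simp: sub_source_def map_le_def)
    moreover have "0 < pr A x"
      using assms(1) X(3) that by (auto simp: is_source_def)
    ultimately show ?thesis
      by simp
  qed
  with X assms interpret enumeration_input X u \<kappa>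
    by unfold_locales auto
  obtain i where enum: "enumeration u \<kappa> X = Some ({}, final_states, i)"
    using enumeration_eq by blast
  have le_source: "\<exists>\<Theta>\<in>final_states. state_bound X \<Theta> \<le> ereal (huffman_redundancy B)"
    if B: "is_source B" "X \<sqsubseteq> B" for B
  proof -
    obtain t where t: "distinct_leaves t" "leaves t = dom B"
      "huffman_redundancy B = redundancy (tree_code t) B"
      using huffman_redundancy_attained(1)[OF B(1)] by blast
    obtain \<Theta> t' r' where \<Theta>: "\<Theta> \<in> final_states" "symbols \<Theta> = {t'}" "weighted_tree X r' t'"
      "tree_redundancy r' t' \<le> tree_redundancy (pr B) t"
      using final_state_le[OF weighted_tree_source[OF B t(1,2)]] by blast
    obtain M where M: "is_source M" "X \<sqsubseteq> M" "dom M = leaves t'"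
      "redundancy (tree_code t') M = tree_redundancy r' t'"
      using ex_source_weighted_tree[OF \<Theta>(3)] by blast
    have "state_bound X \<Theta> \<le> ereal (redundancy (tree_code t') M)"
      using code_bound_attained(2)[OF M(1-3)] \<Theta>(2) by (simp add: state_bound_def)
    also have "\<dots> \<le> ereal (huffman_redundancy B)"
      using M(4) \<Theta>(4) t redundancy_tree_code[OF t(1) t(2)[symmetric]] by simp
    finally show ?thesis
      using \<Theta>(1) by blast
  qed
  \<comment> \<open>The value is \<open>\<infinity>\<close> if no source extending \<open>X\<close>
    has the leaves of the code as its alphabet, for instance if the code has no new symbols while
    the probabilities in \<open>X\<close> sum to less than 1.\<close>
  have state_bound_cases: "state_bound X \<Theta> = \<infinity> \<or>
      (\<exists>M. is_source M \<and> X \<sqsubseteq> M \<and> ereal (huffman_redundancy M) \<le> state_bound X \<Theta>)"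
    if "\<Theta> \<in> final_states" for \<Theta>
  proof -
    obtain i where "well_formed \<Theta>" "card (symbols \<Theta>) = 1"
      using \<open>\<Theta> \<in> final_states\<close> well_formed_reached unfolding final_states_def by blast
    then obtain t where t: "symbols \<Theta> = {t}" "distinct_leaves t"
      by (auto simp: card_1_singleton_iff well_formed_def forest_def)
    have bound: "state_bound X \<Theta> = code_bound X (leaves t) (tree_code t)"
      using t(1) by (simp add: state_bound_def)
    show ?thesis
    proof (cases "{B. is_source B \<and> X \<sqsubseteq> B \<and> dom B = leaves t} = {}")
      case True
      then have "state_bound X \<Theta> = \<infinity>"
        unfolding bound code_bound_def Let_def by (simp only: if_True simp_thms)
      then show ?thesis ..
    next
      case False
      then obtain B where "is_source B" "X \<sqsubseteq> B" "dom B = leaves t"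
        by blast
      from code_bound_attained(1)[OF this, of "tree_code t"] obtain M
        where M: "is_source M" "X \<sqsubseteq> M" "dom M = leaves t"
          "state_bound X \<Theta> = ereal (redundancy (tree_code t) M)"
        unfolding bound by blast
      have "prefix_free_on (dom M) (tree_code t)"
        using prefix_free_tree_code[OF t(2)] M(3) by simp
      then show ?thesis
        using huffman_redundancy_attained(2)[OF M(1)] M by auto
    qed
  qed
  have fin: "finite (state_bound X ` final_states)"
    by (intro finite_imageI finite_final_states)
  have "state_bound X ` final_states \<noteq> {}"
    using le_source[OF assms(1,2)] by blast
  from Min_in[OF fin this] obtain \<Theta>
    where \<Theta>: "\<Theta> \<in> final_states" "Min (state_bound X ` final_states) = state_bound X \<Theta>"
    by (rule imageE)
  have least: "state_bound X \<Theta> \<le> state_bound X \<Theta>'" if "\<Theta>' \<in> final_states" for \<Theta>'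
    unfolding \<Theta>(2)[symmetric] using fin that by (intro Min_le imageI)
  \<comment> \<open>The given source \<open>A\<close> extends \<open>X\<close>, so some output state
    has a finite value.\<close>
  have "state_bound X \<Theta> \<noteq> \<infinity>"
    using le_source[OF assms(1,2)] least by fastforce
  then obtain M where M: "is_source M" "X \<sqsubseteq> M" "ereal (huffman_redundancy M) \<le> state_bound X \<Theta>"
    using state_bound_cases[OF \<Theta>(1)] by blast
  have le: "state_bound X \<Theta> \<le> ereal (huffman_redundancy B)" if "is_source B" "X \<sqsubseteq> B" for B
    using le_source[OF that] least order_trans by blast
  \<comment> \<open>The Huffman redundancy of \<open>M\<close> is at most the least state value,
    which is at most that of every source. Applied to \<open>M\<close> itself, this also forces the
    two values to be equal.\<close>
  have min_H: "is_minimum (huffman_redundancy M) (huffman_redundancies X)"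
    unfolding is_minimum_def huffman_redundancies_def
    using M order_trans[OF M(3) le] by auto
  then have eq: "general_bound X = huffman_redundancy M"
    unfolding general_bound_def by (rule minimum_eqI)
  have "state_bound X \<Theta> = ereal (general_bound X)"
    unfolding eq using M le[OF M(1,2)] by (intro antisym)
  then have "is_minimum (ereal (general_bound X)) (state_bound X ` final_states)"
    unfolding is_minimum_def using \<Theta>(1) least by (metis imageE imageI)
  moreover have "is_minimum (general_bound X) (huffman_redundancies X)"
    unfolding eq by (rule min_H)
  ultimately show ?thesis
    using enum finite_final_states by blast
qed

end
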